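(* Let $D$ be a 2-dimensional regular local ring. Assume that $D$ is Henselian and $\mathcal U$ is a set of pairwise incomparable (with respect to inclusion) rings in $Q(D)$. Then the representation $\mathcal O_{\mathcal U}=\bigcap_{\alpha\in\mathcal U}\alpha$ is irredundant.
   Context: $D$ has quotient field $F$. For a 2-dimensional regular local ring $S$ with maximal ideal $\mathfrak m_S$, a local quadratic transform of $S$ is a localization of $S[\mathfrak m_S/a]$ (with $a\in\mathfrak m_S\setminus\mathfrak m_S^2$) at a height 2 maximal ideal. $Q(D)$ is the set, ordered by inclusion, of all rings obtained from $D$ by a finite (possibly zero) number of successive local quadratic transforms; it is the set of all 2-dimensional regular local rings with quotient field $F$ that dominate $D$. For $\mathcal U\subseteq Q(D)$, $\mathcal O_{\mathcal U}=\bigcap_{\alpha\in\mathcal U}\alpha$ (intersection inside $F$, an empty intersection being $F$). The representation $\mathcal O_{\mathcal U}=\bigcap_{\alpha\in\mathcal U}\alpha$ is irredundant if $\mathcal O_{\mathcal U}\subsetneq\mathcal O_{\mathcal U\setminus\{\alpha\}}$ for each $\alpha\in\mathcal U$. *)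

theory Defs
  imports
    "HOL-Library.Extended_Nat"
    "HOL-Computational_Algebra.Polynomial"
    "HOL-Algebra.Ring_Divisibility"
    "HOL-Algebra.Ideal_Product"
    "HOL-Algebra.Generated_Rings"
    "HOL-Algebra.Algebraic_Closure_Type"
begin

section \<open>Krull dimension and regular local rings\<close>

definition prime_chain :: "('a, 'b) ring_scheme \<Rightarrow> (nat \<Rightarrow> 'a set) \<Rightarrow> nat \<Rightarrow> bool" where
  "prime_chain R P n \<longleftrightarrow> (\<forall>i\<le>n. primeideal (P i) R) \<and> (\<forall>i<n. P i \<subset> P (Suc i))"

text \<open>The zero ring, which has no prime ideals, gets dimension 0 here.\<close>

definition krull_dim :: "('a, 'b) ring_scheme \<Rightarrow> enat" where
  "krull_dim R = Sup {enat n | n. \<exists>P. prime_chain R P n}"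

definition height :: "('a, 'b) ring_scheme \<Rightarrow> 'a set \<Rightarrow> enat" where
  "height R I = Sup {enat n | n. \<exists>P. prime_chain R P n \<and> P n = I}"

definition local_ring :: "('a, 'b) ring_scheme \<Rightarrow> bool" where
  "local_ring R \<longleftrightarrow> cring R \<and> (\<exists>!M. maximalideal M R)"

text \<open>Only meaningful for local rings.\<close>

definition max_ideal :: "('a, 'b) ring_scheme \<Rightarrow> 'a set" where
  "max_ideal R = (THE M. maximalideal M R)"

definition regular_local_ring :: "('a, 'b) ring_scheme \<Rightarrow> bool" where
  "regular_local_ring R \<longleftrightarrow>
     local_ring R \<and> noetherian_ring R \<and>
     (\<exists>A \<subseteq> carrier R. finite A \<and> enat (card A) = krull_dim R \<and> max_ideal R = Idl\<^bsub>R\<^esub> A)"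


section \<open>Subrings of a field\<close>

text \<open>
  The ambient field is the universe of a type of class \<open>field\<close>; its subrings are sets,
  which \<open>ring_on\<close> turns into records.
\<close>

definition ring_on :: "'a::field set \<Rightarrow> 'a ring" where
  "ring_on S = ring_of_type_algebra\<lparr>carrier := S\<rparr>"

definition is_quotient_field_of :: "'a::field set \<Rightarrow> bool" where
  "is_quotient_field_of D \<longleftrightarrow> (\<forall>x. \<exists>a\<in>D. \<exists>b\<in>D. b \<noteq> 0 \<and> x = a / b)"

definition localization_at :: "'a::field set \<Rightarrow> 'a set \<Rightarrow> 'a set" where
  "localization_at B P = {x / s | x s. x \<in> B \<and> s \<in> B - P}"

text \<open>
  Hensel's lemma for a local subring \<open>D\<close> with maximal ideal \<open>m\<close>: if a monic
  \<open>f \<in> D[X]\<close> satisfies \<open>f \<equiv> g\<^sub>0 h\<^sub>0\<close> modulo \<open>m D[X]\<close> with \<open>g\<^sub>0\<close>, \<open>h\<^sub>0\<close> monic and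
  \<open>g\<^sub>0 D[X] + h\<^sub>0 D[X] + m D[X] = D[X]\<close> (that is, coprime over the residue field), then the
  factorization lifts to \<open>D\<close>.
\<close>

definition poly_over :: "'a::field set \<Rightarrow> 'a poly set" where
  "poly_over S = {p. \<forall>i. Polynomial.coeff p i \<in> S}"

definition henselian :: "'a::field set \<Rightarrow> bool" where
  "henselian D \<longleftrightarrow> local_ring (ring_on D) \<and>
     (let m = max_ideal (ring_on D) in
      \<forall>f \<in> poly_over D. \<forall>g\<^sub>0 \<in> poly_over D. \<forall>h\<^sub>0 \<in> poly_over D.
        lead_coeff f = 1 \<and> lead_coeff g\<^sub>0 = 1 \<and> lead_coeff h\<^sub>0 = 1 \<and>
        f - g\<^sub>0 * h\<^sub>0 \<in> poly_over m \<and>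
        (\<exists>u \<in> poly_over D. \<exists>v \<in> poly_over D. u * g\<^sub>0 + v * h\<^sub>0 - 1 \<in> poly_over m) \<longrightarrow>
        (\<exists>g \<in> poly_over D. \<exists>h \<in> poly_over D.
           lead_coeff g = 1 \<and> lead_coeff h = 1 \<and> f = g * h \<and>
           g - g\<^sub>0 \<in> poly_over m \<and> h - h\<^sub>0 \<in> poly_over m))"


section \<open>Quadratic transforms and irredundant intersections\<close>

text \<open>The ring \<open>S[m/a]\<close>, where \<open>m\<close> is the maximal ideal of \<open>S\<close>.\<close>

definition blowup_chart :: "'a::field set \<Rightarrow> 'a \<Rightarrow> 'a set" where
  "blowup_chart S a =
     generate_ring ring_of_type_algebra (S \<union> {x / a | x. x \<in> max_ideal (ring_on S)})"

definition local_quadratic_transform :: "'a::field set \<Rightarrow> 'a set \<Rightarrow> bool" where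
  "local_quadratic_transform S T \<longleftrightarrow>
     (let m = max_ideal (ring_on S) in
      \<exists>a \<in> m - ideal_prod (ring_on S) m m. \<exists>P.
        maximalideal P (ring_on (blowup_chart S a)) \<and>
        height (ring_on (blowup_chart S a)) P = 2 \<and>
        T = localization_at (blowup_chart S a) P)"

inductive_set quadratic_tree :: "'a::field set \<Rightarrow> 'a set set" for D where
  root: "D \<in> quadratic_tree D"
| transform: "S \<in> quadratic_tree D \<Longrightarrow> local_quadratic_transform S T \<Longrightarrow> T \<in> quadratic_tree D"

text \<open>
  \<open>\<Inter>U\<close> is the intersection inside the field; in particular \<open>\<Inter>{} = UNIV\<close> is the field itself.
\<close>

definition irredundant :: "'a set set \<Rightarrow> bool" where
  "irredundant U \<longleftrightarrow> (\<forall>\<alpha>\<in>U. \<Inter>U \<subset> \<Inter>(U - {\<alpha>}))"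

end

theory Submission
  imports Defs
begin

text \<open>
  For \<open>\<alpha> \<in> U\<close> one finds \<open>f \<in> D\<close> whose strict transform passes through \<open>\<alpha>\<close> but through no point of
  the tree that is incomparable with \<open>\<alpha>\<close>. Over such a point \<open>\<beta>\<close> the element \<open>f\<close> is a product of
  exceptional parameters and a unit, so \<open>m\<^sub>D\<^sup>N \<subseteq> f \<beta>\<close> with \<open>N\<close> independent of \<open>\<beta>\<close>, whereas in \<open>\<alpha>\<close> some
  \<open>c \<in> m\<^sub>D\<close> has no power divisible by \<open>f\<close>. Then \<open>c\<^sup>N / f\<close> lies in every member of \<open>U\<close> except \<open>\<alpha>\<close>.

  The element \<open>f\<close> is built by descending the chain of transforms from \<open>\<alpha>\<close> to \<open>D\<close>. To descend from
  \<open>T\<close> to \<open>S\<close>, where \<open>T\<close> lies over the point \<open>p = 0\<close> of the exceptional line, one multiplies by a power of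
  the exceptional parameter. No further point of that line is hit if the initial form
  becomes a power of \<open>p\<close>. This can be arranged beforehand by a Weierstrass preparation modulo a high power of
  the maximal ideal of \<open>T\<close>: it changes the given element only by a unit and by an element of
  that power, which affects nothing that happens above \<open>T\<close>.
\<close>

section \<open>Ideals of subrings of a field\<close>

text \<open>Points of the tree are handled through pairs of parameters that form a regular sequence.
  The chain condition enters at the root, where a principal ideal argument yields such a pair; every
  transform then inherits the property from its predecessor by a computation with polynomials in
  \<open>y / x\<close>. The other inherited datum is a bound on the dimension: it forces a height 2
  maximal ideal of a chart to contain the exceptional parameter.

  Two choices make \<open>c\<close> and \<open>f\<close> incompatible at \<alpha>. As a regular
  parameter of \<open>D\<close>, \<open>c\<close> is a unit times a monomial in suitable parameters
  \<open>u\<close>, \<open>v\<close> at every point of the tree. For this very pair at \<alpha> the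
  strict transform of \<open>f\<close> is kept of the form unit times \<open>u\<close> plus unit
  times \<open>v\<close>, and the regular sequence property shows that it divides no unit times a
  monomial.

  The Weierstrass form has to be monic of full degree, not just a power of \<open>p\<close> modulo
  the maximal ideal: the leading coefficient is what keeps the strict transform away from the point
  at infinity of the exceptional line, which the chart does not see.\<close>

locale field_subring =
  fixes S :: "'a::field set"
  assumes zero_in [simp, intro]: "0 \<in> S" and one_in [simp, intro]: "1 \<in> S"
    and add_in [simp, intro]: "x \<in> S \<Longrightarrow> y \<in> S \<Longrightarrow> x + y \<in> S"
    and uminus_in [simp, intro]: "x \<in> S \<Longrightarrow> - x \<in> S"
    and mult_in [simp, intro]: "x \<in> S \<Longrightarrow> y \<in> S \<Longrightarrow> x * y \<in> S"
begin

lemma diff_in [simp, intro]: "x \<in> S \<Longrightarrow> y \<in> S \<Longrightarrow> x - y \<in> S"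
  using add_in[of x "- y"] by simp

lemma power_in [simp, intro]: "x \<in> S \<Longrightarrow> x ^ n \<in> S"
  by (induction n) auto

lemma sum_in [intro]: "(\<And>i. i \<in> I \<Longrightarrow> f i \<in> S) \<Longrightarrow> sum f I \<in> S"
  by (induction I rule: infinite_finite_induct) auto

lemma ring_on_simps [simp]:
  "carrier (ring_on S) = S" "\<one>\<^bsub>ring_on S\<^esub> = 1" "\<zero>\<^bsub>ring_on S\<^esub> = 0"
  "(\<oplus>\<^bsub>ring_on S\<^esub>) = (+)" "(\<otimes>\<^bsub>ring_on S\<^esub>) = (*)"
  by (auto simp: ring_on_def ring_of_type_algebra_def)

lemma cring_ring_on: "cring (ring_on S)"
proof (intro cringI abelian_groupI comm_monoidI)
  fix x assume "x \<in> carrier (ring_on S)"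
  then show "\<exists>y\<in>carrier (ring_on S). y \<oplus>\<^bsub>ring_on S\<^esub> x = \<zero>\<^bsub>ring_on S\<^esub>"
    by (intro bexI[of _ "- x"]) auto
qed (auto simp: algebra_simps)

lemma ideal_iff:
  "ideal I (ring_on S) \<longleftrightarrow>
     I \<subseteq> S \<and> 0 \<in> I \<and> (\<forall>x\<in>I. \<forall>y\<in>I. x + y \<in> I) \<and> (\<forall>x\<in>I. \<forall>s\<in>S. s * x \<in> I)"
proof
  assume "ideal I (ring_on S)"
  then interpret ideal I "ring_on S" .
  show "I \<subseteq> S \<and> 0 \<in> I \<and> (\<forall>x\<in>I. \<forall>y\<in>I. x + y \<in> I) \<and> (\<forall>x\<in>I. \<forall>s\<in>S. s * x \<in> I)"
    using a_subset additive_subgroup.zero_closed[OF is_additive_subgroup]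
      additive_subgroup.a_closed[OF is_additive_subgroup] I_l_closed by simp
next
  interpret cring "ring_on S" by (rule cring_ring_on)
  assume I: "I \<subseteq> S \<and> 0 \<in> I \<and> (\<forall>x\<in>I. \<forall>y\<in>I. x + y \<in> I) \<and> (\<forall>x\<in>I. \<forall>s\<in>S. s * x \<in> I)"
  have neg: "- x \<in> I" if "x \<in> I" for x
    using I that one_in uminus_in mult_minus1 by metis
  have inv: "inv\<^bsub>add_monoid (ring_on S)\<^esub> x = - x" if "x \<in> I" for x
    using add.inv_equality[of "- x" x] I that by (auto simp: a_inv_def)
  show "ideal I (ring_on S)"
  proof (rule idealI)
    show "subgroup I (add_monoid (ring_on S))"
      by (rule subgroup.intro) (use I neg inv in auto)
  qed (use I ring_axioms in \<open>auto simp: mult.commute\<close>)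
qed

lemma idealD:
  assumes "ideal I (ring_on S)"
  shows "I \<subseteq> S" "0 \<in> I" "x \<in> I \<Longrightarrow> x \<in> S" "x \<in> I \<Longrightarrow> y \<in> I \<Longrightarrow> x + y \<in> I"
    "x \<in> I \<Longrightarrow> s \<in> S \<Longrightarrow> s * x \<in> I" "x \<in> I \<Longrightarrow> s \<in> S \<Longrightarrow> x * s \<in> I"
    "x \<in> I \<Longrightarrow> - x \<in> I" "x \<in> I \<Longrightarrow> y \<in> I \<Longrightarrow> x - y \<in> I"
proof -
  note * = assms[unfolded ideal_iff]
  show "I \<subseteq> S" "0 \<in> I" "x \<in> I \<Longrightarrow> x \<in> S" "x \<in> I \<Longrightarrow> y \<in> I \<Longrightarrow> x + y \<in> I"
    "x \<in> I \<Longrightarrow> s \<in> S \<Longrightarrow> s * x \<in> I" "x \<in> I \<Longrightarrow> s \<in> S \<Longrightarrow> x * s \<in> I"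
    using * by (auto simp: mult.commute)
  have neg: "- x \<in> I" if "x \<in> I" for x
    using * that one_in uminus_in mult_minus1 by metis
  show "x \<in> I \<Longrightarrow> - x \<in> I" "x \<in> I \<Longrightarrow> y \<in> I \<Longrightarrow> x - y \<in> I"
    using * neg diff_conv_add_uminus by metis+
qed

lemma ideal_multiples:
  assumes s: "s \<in> S" shows "ideal {s * v | v. v \<in> S} (ring_on S)"
  unfolding ideal_iff
proof (intro conjI ballI)
  show "{s * v | v. v \<in> S} \<subseteq> S" using s by auto
  show "0 \<in> {s * v | v. v \<in> S}" using zero_in by force
next
  fix a b assume "a \<in> {s * v | v. v \<in> S}" "b \<in> {s * v | v. v \<in> S}"
  then obtain v w where "a = s * v" "b = s * w" "v \<in> S" "w \<in> S" by blast
  then have "a + b = s * (v + w)" "v + w \<in> S" by (auto simp: algebra_simps)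
  then show "a + b \<in> {s * v | v. v \<in> S}" by blast
next
  fix a r assume "a \<in> {s * v | v. v \<in> S}" and r: "r \<in> S"
  then obtain v where "a = s * v" "v \<in> S" by blast
  then have "r * a = s * (r * v)" "r * v \<in> S" using r by (auto simp: algebra_simps)
  then show "r * a \<in> {s * v | v. v \<in> S}" by blast
qed

lemma ideal_add_multiples:
  assumes I: "ideal I (ring_on S)" and s: "s \<in> S"
  shows "ideal {i + s * v | i v. i \<in> I \<and> v \<in> S} (ring_on S)" (is "ideal ?J _")
  unfolding ideal_iff
proof (intro conjI ballI)
  show "?J \<subseteq> S" using idealD(1)[OF I] s by auto
  have "0 = 0 + s * 0" by simp
  then show "0 \<in> ?J" using idealD(2)[OF I] zero_in by blast
next
  fix a b assume "a \<in> ?J" "b \<in> ?J"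
  then obtain i v j w where "a = i + s * v" "b = j + s * w" "i \<in> I" "v \<in> S" "j \<in> I" "w \<in> S" by blast
  then have "a + b = (i + j) + s * (v + w)" "i + j \<in> I" "v + w \<in> S"
    by (auto simp: algebra_simps intro: idealD(4-8)[OF I])
  then show "a + b \<in> ?J" by blast
next
  fix a r assume "a \<in> ?J" and r: "r \<in> S"
  then obtain i v where "a = i + s * v" "i \<in> I" "v \<in> S" by blast
  then have "r * a = r * i + s * (r * v)" "r * i \<in> I" "r * v \<in> S"
    using r by (auto simp: algebra_simps intro: idealD(4-8)[OF I])
  then show "r * a \<in> ?J" by blast
qed

lemma ideal_two_generated:
  assumes "a \<in> S" "b \<in> S"
  shows "ideal {a * u + b * v | u v. u \<in> S \<and> v \<in> S} (ring_on S)"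
proof -
  have "{a * u + b * v | u v. u \<in> S \<and> v \<in> S} =
      {i + b * v | i v. i \<in> {a * u | u. u \<in> S} \<and> v \<in> S}"
    by blast
  then show ?thesis using ideal_add_multiples[OF ideal_multiples] assms by simp
qed

lemma primeideal_iff:
  "primeideal I (ring_on S) \<longleftrightarrow>
     ideal I (ring_on S) \<and> 1 \<notin> I \<and> (\<forall>a\<in>S. \<forall>b\<in>S. a * b \<in> I \<longrightarrow> a \<in> I \<or> b \<in> I)"
proof
  assume "primeideal I (ring_on S)"
  then interpret primeideal I "ring_on S" .
  show "ideal I (ring_on S) \<and> 1 \<notin> I \<and> (\<forall>a\<in>S. \<forall>b\<in>S. a * b \<in> I \<longrightarrow> a \<in> I \<or> b \<in> I)"
    using is_ideal I_notcarr one_imp_carrier I_prime by auto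
next
  assume *: "ideal I (ring_on S) \<and> 1 \<notin> I \<and> (\<forall>a\<in>S. \<forall>b\<in>S. a * b \<in> I \<longrightarrow> a \<in> I \<or> b \<in> I)"
  show "primeideal I (ring_on S)"
    by (rule primeidealI) (use * cring_ring_on one_in in auto)
qed

text \<open>The quotient is a field, written with elements. This form supplies the inverses modulo a
  maximal ideal of a chart that later become the \<open>invert\<close> property of a
  transform.\<close>

lemma maximalideal_iff:
  "maximalideal I (ring_on S) \<longleftrightarrow>
     ideal I (ring_on S) \<and> 1 \<notin> I \<and> (\<forall>s\<in>S - I. \<exists>v\<in>S. s * v - 1 \<in> I)"
proof
  assume "maximalideal I (ring_on S)"
  then interpret maximalideal I "ring_on S" .
  have I: "I \<subseteq> S" "0 \<in> I" "\<And>x y. x \<in> I \<Longrightarrow> y \<in> I \<Longrightarrow> x + y \<in> I"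
    "\<And>x s. x \<in> I \<Longrightarrow> s \<in> S \<Longrightarrow> s * x \<in> I"
    using is_ideal ideal_iff by auto
  have "\<exists>v\<in>S. s * v - 1 \<in> I" if s: "s \<in> S - I" for s
  proof -
    define J where "J = {i + s * v | i v. i \<in> I \<and> v \<in> S}"
    have J: "ideal J (ring_on S)" unfolding J_def by (rule ideal_add_multiples) (use is_ideal s in auto)
    have IJ: "I \<subseteq> J" unfolding J_def using zero_in by force
    have "s = 0 + s * 1" by simp
    then have "s \<in> J" unfolding J_def using I one_in by blast
    then have "J = S" using I_maximal[OF J IJ] s J ideal_iff by auto
    then have "1 \<in> J" by simp
    then obtain i v where iv: "1 = i + s * v" "i \<in> I" "v \<in> S" by (auto simp: J_def)
    then have "s * v - 1 = - 1 * i" by (simp add: algebra_simps)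
    then show ?thesis using iv I uminus_in one_in by metis
  qed
  then show "ideal I (ring_on S) \<and> 1 \<notin> I \<and> (\<forall>s\<in>S - I. \<exists>v\<in>S. s * v - 1 \<in> I)"
    using is_ideal I_notcarr one_imp_carrier by auto
next
  assume *: "ideal I (ring_on S) \<and> 1 \<notin> I \<and> (\<forall>s\<in>S - I. \<exists>v\<in>S. s * v - 1 \<in> I)"
  show "maximalideal I (ring_on S)"
  proof (rule maximalidealI)
    show "ideal I (ring_on S)" using * by blast
    show "carrier (ring_on S) \<noteq> I" using * one_in by auto
    fix J assume J: "ideal J (ring_on S)" "I \<subseteq> J" "J \<subseteq> carrier (ring_on S)"
    show "J = I \<or> J = carrier (ring_on S)"
    proof (cases "J = I")
      case False
      then obtain s where s: "s \<in> J" "s \<notin> I" using J by blast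
      then obtain v where v: "v \<in> S" "s * v - 1 \<in> I" using * J by (meson DiffI idealD(3))
      have "v * s \<in> J" "s * v - 1 \<in> J"
        using J v s by (auto intro: idealD)
      then have "v * s - (s * v - 1) \<in> J" using J by (blast intro: idealD)
      then have one: "1 \<in> J" by (simp add: algebra_simps)
      have "r \<in> J" if "r \<in> S" for r
        using J one that mult.right_neutral unfolding ideal_iff by metis
      then show ?thesis using J by auto
    qed simp
  qed
qed

lemma maximalideal_imp_primeideal:
  assumes "maximalideal I (ring_on S)" shows "primeideal I (ring_on S)"
  unfolding primeideal_iff
proof (intro conjI ballI impI)
  show I: "ideal I (ring_on S)" "1 \<notin> I" using assms maximalideal_iff by auto
  fix a b assume ab: "a \<in> S" "b \<in> S" "a * b \<in> I"
  show "a \<in> I \<or> b \<in> I"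
  proof (rule disjCI)
    assume "b \<notin> I"
    then obtain v where v: "v \<in> S" "b * v - 1 \<in> I" using assms ab maximalideal_iff by auto
    have "v * (a * b) \<in> I" "- a * (b * v - 1) \<in> I"
      using I v ab by (auto intro: idealD)
    then have "v * (a * b) + - a * (b * v - 1) \<in> I" using I by (blast intro: idealD)
    then show "a \<in> I" by (simp add: algebra_simps)
  qed
qed

end

text \<open>For a local ring this is the maximal ideal, but described without a choice of ideal, so
  that domination of local rings becomes an inclusion of sets of nonunits.\<close>

definition nonunits :: "'a::field set \<Rightarrow> 'a set" where
  "nonunits S = {s \<in> S. \<forall>t\<in>S. s * t \<noteq> 1}"

lemma nonunits_subset: "nonunits S \<subseteq> S"
  by (auto simp: nonunits_def)

context field_subring begin

lemma ideal_subset_nonunits: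
  assumes "ideal I (ring_on S)" "1 \<notin> I" shows "I \<subseteq> nonunits S"
proof
  fix x assume "x \<in> I"
  then show "x \<in> nonunits S"
    using idealD[OF assms(1)] assms(2) unfolding nonunits_def by fastforce
qed

lemma nonunits_mult:
  assumes "u \<in> S" "x \<in> nonunits S" shows "u * x \<in> nonunits S"
proof -
  have "u * x * t \<noteq> 1" if "t \<in> S" for t
  proof -
    have "x * (u * t) \<noteq> 1" using assms that mult_in unfolding nonunits_def by blast
    then show ?thesis by (simp add: mult_ac)
  qed
  then show ?thesis using assms mult_in unfolding nonunits_def by blast
qed

lemma unitD:
  assumes "u \<in> S - nonunits S" shows "inverse u \<in> S" "u \<noteq> 0"
proof -
  obtain t where "t \<in> S" "u * t = 1" using assms unfolding nonunits_def by blast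
  then show "inverse u \<in> S" "u \<noteq> 0" using inverse_unique[of u t] by auto
qed

lemma zero_nonunits [simp]: "0 \<in> nonunits S"
  by (auto simp: nonunits_def)

lemma one_not_nonunits [simp]: "1 \<notin> nonunits S"
  by (auto simp: nonunits_def)

lemma maximalideal_nonunits:
  assumes "ideal (nonunits S) (ring_on S)"
  shows "maximalideal J (ring_on S) \<longleftrightarrow> J = nonunits S"
proof -
  have m: "maximalideal (nonunits S) (ring_on S)"
    unfolding maximalideal_iff
  proof (intro conjI assms ballI)
    show "1 \<notin> nonunits S" by simp
    fix s assume "s \<in> S - nonunits S"
    then obtain v where "v \<in> S" "s * v = 1" by (auto simp: nonunits_def)
    then show "\<exists>v\<in>S. s * v - 1 \<in> nonunits S" by force
  qed
  have "J = nonunits S" if J: "maximalideal J (ring_on S)"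
  proof -
    have "J \<subseteq> nonunits S" using J ideal_subset_nonunits maximalideal_iff by blast
    then show ?thesis
      using maximalideal.I_maximal[OF J assms] nonunits_subset[of S] one_not_nonunits one_in
      by (metis ring_on_simps(1))
  qed
  then show ?thesis using m by blast
qed

lemma max_ideal_eq_nonunits:
  assumes "ideal (nonunits S) (ring_on S)" shows "max_ideal (ring_on S) = nonunits S"
  unfolding max_ideal_def maximalideal_nonunits[OF assms] by simp

text \<open>Zorn's lemma, where the chain condition makes the union of a nonempty chain one of its
  members. It places the ideal generated by any nonunit inside the unique maximal ideal of a local
  ring.\<close>

lemma noetherian_exists_maximalideal:
  assumes "noetherian_ring (ring_on S)" and I: "ideal I (ring_on S)" "1 \<notin> I"
  shows "\<exists>M. maximalideal M (ring_on S) \<and> I \<subseteq> M"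
proof -
  interpret noetherian_ring "ring_on S" by fact
  define \<Q> where "\<Q> = {J. ideal J (ring_on S) \<and> 1 \<notin> J \<and> I \<subseteq> J}"
  have "\<exists>M\<in>\<Q>. \<forall>J\<in>\<Q>. M \<subseteq> J \<longrightarrow> J = M"
  proof (rule subset_Zorn)
    fix C assume C: "subset.chain \<Q> C"
    show "\<exists>J\<in>\<Q>. \<forall>J'\<in>C. J' \<subseteq> J"
    proof (cases "C = {}")
      case False
      have "subset.chain {J. ideal J (ring_on S)} C"
        using C by (auto simp: pred_on.chain_def \<Q>_def)
      then have "\<Union>C \<in> C" by (rule ideal_chain_is_trivial[OF False])
      then show ?thesis using C by (intro bexI[of _ "\<Union>C"]) (auto simp: pred_on.chain_def)
    qed (use I in \<open>auto simp: \<Q>_def\<close>)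
  qed
  then obtain M where M: "M \<in> \<Q>" "\<And>J. J \<in> \<Q> \<Longrightarrow> M \<subseteq> J \<Longrightarrow> J = M" by blast
  have "maximalideal M (ring_on S)"
  proof (rule maximalidealI)
    show "ideal M (ring_on S)" "carrier (ring_on S) \<noteq> M" using M(1) one_in by (auto simp: \<Q>_def)
    fix J assume J: "ideal J (ring_on S)" "M \<subseteq> J"
    show "J = M \<or> J = carrier (ring_on S)"
    proof (cases "1 \<in> J")
      case True
      then show ?thesis using ideal.one_imp_carrier[OF J(1)] by simp
    next
      case False
      then have "J \<in> \<Q>" using J M(1) by (auto simp: \<Q>_def)
      then show ?thesis using M(2) J by blast
    qed
  qed
  then show ?thesis using M(1) by (auto simp: \<Q>_def)
qed

lemma local_ring_imp_ideal_nonunits: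
  assumes "local_ring (ring_on S)" "noetherian_ring (ring_on S)" shows "ideal (nonunits S) (ring_on S)"
proof -
  interpret cring "ring_on S" by (rule cring_ring_on)
  obtain M where M: "maximalideal M (ring_on S)" "\<And>J. maximalideal J (ring_on S) \<Longrightarrow> J = M"
    using assms unfolding local_ring_def by blast
  have "nonunits S \<subseteq> M"
  proof
    fix s assume s: "s \<in> nonunits S"
    define J where "J = {s * r | r. r \<in> S}"
    have "ideal J (ring_on S)"
      unfolding J_def using s nonunits_subset by (blast intro: ideal_multiples)
    moreover have "1 \<notin> J" using s by (auto simp: J_def nonunits_def)
    ultimately obtain K where "maximalideal K (ring_on S)" "J \<subseteq> K"
      using noetherian_exists_maximalideal[OF assms(2)] by blast
    moreover have "s \<in> J" unfolding J_def using one_in by force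
    ultimately show "s \<in> M" using M by blast
  qed
  moreover have M': "ideal M (ring_on S)" "1 \<notin> M" using M(1) maximalideal_iff by blast+
  ultimately show ?thesis using ideal_subset_nonunits[OF M'] by (metis subset_antisym)
qed

end


section \<open>Two-generated maximal ideals\<close>

lemma prime_chain_mono: "prime_chain R P n \<Longrightarrow> k \<le> n \<Longrightarrow> prime_chain R P k"
  by (auto simp: prime_chain_def)

lemma krull_dim_le_iff: "krull_dim R \<le> enat n \<longleftrightarrow> (\<forall>P. \<not> prime_chain R P (Suc n))"
proof
  assume le: "krull_dim R \<le> enat n"
  show "\<forall>P. \<not> prime_chain R P (Suc n)"
  proof (intro allI notI)
    fix P assume "prime_chain R P (Suc n)"
    then have "enat (Suc n) \<le> krull_dim R"
      unfolding krull_dim_def by (auto intro!: Sup_upper)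
    then show False using order_trans[OF _ le, of "enat (Suc n)"] by simp
  qed
next
  assume no: "\<forall>P. \<not> prime_chain R P (Suc n)"
  have "k \<le> n" if "prime_chain R P k" for k P
    using prime_chain_mono[OF that, of "Suc n"] no by (meson not_less_eq_eq)
  then show "krull_dim R \<le> enat n"
    unfolding krull_dim_def by (intro Sup_least) auto
qed

text \<open>If the value were not attained, \<open>N\<close> would already be an upper bound.
  Writing the supremum as \<open>Suc N\<close> excludes the value 0, which the empty set also has as
  its supremum.\<close>

lemma Sup_enat_attained:
  assumes "Sup {enat n | n. Q n} = enat (Suc N)"
  shows "Q (Suc N)" "Q n \<Longrightarrow> n \<le> Suc N"
proof -
  have *: "k \<le> Suc N" if "Q k" for k
  proof -
    have "enat k \<le> Sup {enat n | n. Q n}" using that by (auto intro!: Sup_upper)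
    then show ?thesis using assms by simp
  qed
  then show "Q n \<Longrightarrow> n \<le> Suc N" by blast
  show "Q (Suc N)"
  proof (rule ccontr)
    assume "\<not> Q (Suc N)"
    then have "k \<le> N" if "Q k" for k using *[OF that] that by (metis le_SucE)
    then have "Sup {enat n | n. Q n} \<le> enat N" by (intro Sup_least) auto
    then show False using assms by simp
  qed
qed

lemma krull_dim_2D:
  assumes "krull_dim R = 2" shows "\<exists>P. prime_chain R P 2"
proof -
  have "Sup {enat n | n. \<exists>P. prime_chain R P n} = enat (Suc 1)"
    using assms by (simp add: krull_dim_def numeral_eq_enat)
  from Sup_enat_attained(1)[OF this] show ?thesis by (simp add: numeral_2_eq_2)
qed

lemma height_2D:
  assumes "height R I = 2"
  shows "\<exists>P. prime_chain R P 2 \<and> P 2 = I" "prime_chain R P 3 \<Longrightarrow> P 3 \<noteq> I"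
proof -
  have *: "Sup {enat n | n. \<exists>P. prime_chain R P n \<and> P n = I} = enat (Suc 1)"
    using assms by (simp add: height_def numeral_eq_enat)
  from Sup_enat_attained(1)[OF this] show "\<exists>P. prime_chain R P 2 \<and> P 2 = I"
    by (simp add: numeral_2_eq_2)
  show "prime_chain R P 3 \<Longrightarrow> P 3 \<noteq> I"
    using Sup_enat_attained(2)[OF *, of 3] by auto
qed

context field_subring begin

lemma nonunits_unit_factor: "u * x \<in> nonunits S \<Longrightarrow> u \<in> S - nonunits S \<Longrightarrow> x \<in> nonunits S"
  using nonunits_mult[of "inverse u" "u * x"] unitD[of u] by (simp add: mult.assoc[symmetric])

lemma unit_mult: "u \<in> S - nonunits S \<Longrightarrow> v \<in> S - nonunits S \<Longrightarrow> u * v \<in> S - nonunits S"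
  using nonunits_unit_factor[of u v] by auto

lemma unit_inverse: "u \<in> S - nonunits S \<Longrightarrow> inverse u \<in> S - nonunits S"
  using nonunits_mult[of u "inverse u"] unitD[of u] by auto

lemma unit_power: "u \<in> S - nonunits S \<Longrightarrow> u ^ n \<in> S - nonunits S"
proof (induction n)
  case (Suc n)
  then show ?case using unit_mult[of u "u ^ n"] by simp
qed simp

lemma unit_add_nonunit:
  assumes "ideal (nonunits S) (ring_on S)" "u \<in> S - nonunits S" "x \<in> nonunits S"
  shows "u + x \<in> S - nonunits S"
proof -
  have "u = (u + x) - x" by simp
  then have "u + x \<notin> nonunits S" using assms idealD(8)[OF assms(1)] by (metis DiffD2)
  then show ?thesis using assms nonunits_subset[of S] by auto
qed

text \<open>A form of Nakayama's lemma that uses the ascending chain condition only for the ideals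
  \<open>N + (d k)\<close>.\<close>

lemma noetherian_absorb:
  assumes "noetherian_ring (ring_on S)" and m: "ideal (nonunits S) (ring_on S)"
    and N: "ideal N (ring_on S)"
    and d: "\<And>k. d k \<in> S" and r: "r \<in> nonunits S"
    and step: "\<And>k. d k - r * d (Suc k) \<in> N"
  shows "d 0 \<in> N"
proof -
  interpret noetherian_ring "ring_on S" by fact
  have rS: "r \<in> S" using r nonunits_subset by blast
  \<comment> \<open>These ideals increase because \<open>d k\<close> is \<open>r * d (Suc k)\<close>
    modulo \<open>N\<close>. Where they become stationary, \<open>d (Suc k)\<close> is
    \<open>s * d k\<close> modulo \<open>N\<close>; substituting puts
    \<open>(1 - s * r) * d (Suc k)\<close> into \<open>N\<close>, and \<open>1 - s * r\<close> is a
    unit. Membership then descends to index 0.\<close>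
  define J where "J k = {n + s * d k | n s. n \<in> N \<and> s \<in> S}" for k
  have J: "ideal (J k) (ring_on S)" for k
    using ideal_add_multiples[OF N d[of k]] by (simp add: J_def mult.commute)
  have incr: "J k \<subseteq> J (Suc k)" for k
  proof
    fix a assume "a \<in> J k"
    then obtain n s where a: "a = n + s * d k" "n \<in> N" "s \<in> S" by (auto simp: J_def)
    have "a = (n + s * (d k - r * d (Suc k))) + (s * r) * d (Suc k)"
      using a by (simp add: algebra_simps)
    moreover have "n + s * (d k - r * d (Suc k)) \<in> N" "s * r \<in> S"
      using a step rS by (auto intro: idealD(4-8)[OF N])
    ultimately show "a \<in> J (Suc k)" unfolding J_def by blast
  qed
  then have mono: "J i \<subseteq> J k" if "i \<le> k" for i k
    using that by (rule lift_Suc_mono_le)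
  have "subset.chain {I. ideal I (ring_on S)} (range J)"
    unfolding subset_chain_def using J mono nat_le_linear by auto blast
  then have "\<Union>(range J) \<in> range J" by (intro ideal_chain_is_trivial) auto
  then obtain k where k: "\<Union>(range J) = J k" by auto
  have "d (Suc k) = 0 + 1 * d (Suc k)" by simp
  then have "d (Suc k) \<in> J (Suc k)" unfolding J_def using idealD(2)[OF N] one_in by blast
  then have "d (Suc k) \<in> J k" using k by blast
  then obtain n s where n: "d (Suc k) = n + s * d k" "n \<in> N" "s \<in> S" by (auto simp: J_def)
  have "(1 - s * r) * d (Suc k) = n + s * (d k - r * d (Suc k))"
    using n(1) by (simp add: algebra_simps)
  then have inN: "(1 - s * r) * d (Suc k) \<in> N"
    using idealD(4)[OF N n(2) idealD(5)[OF N step[of k] n(3)]] by simp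
  have "1 + - (s * r) \<in> S - nonunits S"
    by (rule unit_add_nonunit[OF m]) (use nonunits_mult[OF n(3) r] in \<open>auto intro: idealD(7)[OF m]\<close>)
  then have u: "inverse (1 - s * r) \<in> S" "1 - s * r \<noteq> 0" using unitD[of "1 - s * r"] by auto
  have "inverse (1 - s * r) * ((1 - s * r) * d (Suc k)) \<in> N"
    by (rule idealD(5)[OF N inN u(1)])
  then have base: "d (Suc k) \<in> N" using u(2) by (simp add: mult.assoc[symmetric])
  have down: "d i \<in> N" if "d (Suc i) \<in> N" for i
  proof -
    have "d i = (d i - r * d (Suc i)) + r * d (Suc i)" by simp
    then show ?thesis using idealD(4)[OF N step] idealD(5)[OF N that rS] by metis
  qed
  have "d (Suc k - i) \<in> N" if "i \<le> Suc k" for i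
    using that
  proof (induction i)
    case (Suc i)
    then show ?case using down[of "Suc k - Suc i"] by (simp add: Suc_diff_le)
  qed (use base in auto)
  from this[of "Suc k"] show ?thesis by simp
qed

end

text \<open>
  The last assumption says that \<open>y, x\<close> is a regular sequence; it replaces both the
  dimension and the noetherian property.
\<close>

locale regular_params = field_subring S for S :: "'a::field set" +
  fixes x y :: 'a
  assumes x_in [simp, intro]: "x \<in> S" and y_in [simp, intro]: "y \<in> S"
    and x_nz: "x \<noteq> 0" and y_nz: "y \<noteq> 0"
    and nonunits_eq: "nonunits S = {x * u + y * v | u v. u \<in> S \<and> v \<in> S}"
    and regular: "u \<in> S \<Longrightarrow> v \<in> S \<Longrightarrow> x * u = y * v \<Longrightarrow> \<exists>w\<in>S. u = y * w"

section \<open>The principal ideal theorem and regular sequences\<close>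

lemma bounded_mono_repeats:
  fixes f :: "nat \<Rightarrow> nat"
  assumes "\<And>j. f j \<le> f (Suc j)" "\<And>j. f j \<le> n"
  shows "\<exists>j. f (Suc j) = f j"
proof (rule ccontr)
  assume "\<nexists>j. f (Suc j) = f j"
  then have "f j < f (Suc j)" for j using assms(1)[of j] by (metis le_neq_implies_less)
  then have "strict_mono f" by (simp add: strict_mono_Suc_iff)
  then have "Suc n \<le> f (Suc n)" by (rule strict_mono_imp_increasing)
  then show False using assms(2)[of "Suc n"] by simp
qed

text \<open>Krull's principal ideal theorem for a maximal ideal generated by two elements, with the
  powers of a principal ideal in place of the symbolic powers of the prime.\<close>

lemma (in field_subring) power_notin_principal:
  assumes noeth: "noetherian_ring (ring_on S)" and m: "ideal (nonunits S) (ring_on S)"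
    and xy: "x \<in> S" "y \<in> S" and gen: "nonunits S = {x * u + y * v | u v. u \<in> S \<and> v \<in> S}"
    and q: "primeideal q (ring_on S)" "q \<noteq> {0}" "q \<noteq> nonunits S"
    and v: "v \<in> S"
  shows "x ^ n \<noteq> y * v"
proof
  assume xn: "x ^ n = y * v"
  have qi: "ideal q (ring_on S)" and q1: "1 \<notin> q"
    and qp: "\<And>a b. a \<in> S \<Longrightarrow> b \<in> S \<Longrightarrow> a * b \<in> q \<Longrightarrow> a \<in> q \<or> b \<in> q"
    using q(1) primeideal_iff by auto
  have xm: "x \<in> nonunits S" "y \<in> nonunits S"
  proof -
    have "x = x * 1 + y * 0" "y = x * 0 + y * 1" by simp_all
    then show "x \<in> nonunits S" "y \<in> nonunits S" unfolding gen using one_in zero_in by blast+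
  qed
  have qm: "q \<subseteq> nonunits S" using ideal_subset_nonunits[OF qi q1] .
  have y: "y \<notin> q"
  proof
    assume y: "y \<in> q"
    have powq: "x \<in> q" if "x ^ k \<in> q" for k
      using that by (induction k) (use q1 qp xy in auto)
    have "x ^ n \<in> q" unfolding xn using y v by (rule idealD(6)[OF qi])
    then have "x \<in> q" by (rule powq)
    then have "nonunits S \<subseteq> q" unfolding gen using y by (auto intro: idealD(4-8)[OF qi])
    then show False using qm q(3) by blast
  qed
  obtain z where z: "z \<in> q" "z \<noteq> 0" using q(2) idealD(2)[OF qi] by blast
  then have zS: "z \<in> S" using idealD[OF qi] by blast
  \<comment> \<open>The contraction to \<open>S\<close> of the \<open>j\<close>-th power of the
    ideal generated by \<open>z\<close> in the localization at \<open>q\<close>.\<close>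
  define I where "I j = {r \<in> S. \<exists>s\<in>S - q. \<exists>d\<in>S. s * r = z ^ j * d}" for j
  have I: "ideal (I j) (ring_on S)" for j
    unfolding ideal_iff
  proof (intro conjI ballI)
    show "I j \<subseteq> S" by (auto simp: I_def)
    show "0 \<in> I j" using q1 by (auto simp: I_def intro!: bexI[of _ 1] bexI[of _ 0])
  next
    fix a b assume "a \<in> I j" "b \<in> I j"
    then obtain s d s' d' where *: "a \<in> S" "b \<in> S" "s \<in> S - q" "s' \<in> S - q" "d \<in> S" "d' \<in> S"
      "s * a = z ^ j * d" "s' * b = z ^ j * d'" by (auto simp: I_def)
    have "(s * s') * (a + b) = s' * (s * a) + s * (s' * b)" by (simp add: algebra_simps)
    also have "\<dots> = z ^ j * (s' * d + s * d')" using * by (simp add: algebra_simps)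
    finally have "(s * s') * (a + b) = z ^ j * (s' * d + s * d')" .
    moreover have "s * s' \<in> S - q" "s' * d + s * d' \<in> S" using * qp by auto
    ultimately show "a + b \<in> I j" using * unfolding I_def by blast
  next
    fix a c assume "a \<in> I j" and c: "c \<in> S"
    then obtain s d where *: "a \<in> S" "s \<in> S - q" "d \<in> S" "s * a = z ^ j * d"
      by (auto simp: I_def)
    then have "s * (c * a) = z ^ j * (c * d)" by (simp add: mult.left_commute)
    then show "c * a \<in> I j" using * c unfolding I_def by blast
  qed
  have I_decr: "I (Suc j) \<subseteq> I j" for j
  proof
    fix a assume "a \<in> I (Suc j)"
    then obtain s d where *: "a \<in> S" "s \<in> S - q" "d \<in> S" "s * a = z ^ j * (z * d)"
      by (auto simp: I_def mult_ac)
    then show "a \<in> I j" using zS unfolding I_def by blast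
  qed
  \<comment> \<open>Since \<open>x ^ n\<close> is a multiple of \<open>y\<close>, these ideals run
    from \<open>S\<close> at \<open>i = 0\<close> down to the multiples of \<open>y\<close> at
    \<open>i = n\<close>. Thus \<open>lev j\<close> measures the size of \<open>I j\<close> modulo
    \<open>y\<close>, in place of a length; being bounded and nondecreasing it must repeat.\<close>
  define A where "A i = {x ^ i * u + y * w | u w. u \<in> S \<and> w \<in> S}" for i
  define lev where "lev j = Max {i. i \<le> n \<and> I j \<subseteq> A i}" for j
  have A0: "S \<subseteq> A 0"
  proof
    fix s assume "s \<in> S"
    moreover have "s = x ^ 0 * s + y * 0" by simp
    ultimately show "s \<in> A 0" unfolding A_def using zero_in by blast
  qed
  have ne: "finite {i. i \<le> n \<and> I j \<subseteq> A i}" "{i. i \<le> n \<and> I j \<subseteq> A i} \<noteq> {}" for j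
    using A0 idealD(1)[OF I[of j]] by auto
  have lev: "lev j \<le> n" "I j \<subseteq> A (lev j)" for j
    using Max_in[OF ne[of j]] unfolding lev_def by auto
  have lev_max: "i \<le> lev j" if "i \<le> n" "I j \<subseteq> A i" for i j
    unfolding lev_def using ne that by (intro Max_ge) auto
  have "lev j \<le> lev (Suc j)" for j
    using lev[of j] I_decr by (intro lev_max) auto
  then obtain j where j: "lev (Suc j) = lev j" using bounded_mono_repeats[of lev n] lev(1) by blast
  have split: "\<exists>d\<in>S. r - y * d \<in> I (Suc j)" if r: "r \<in> I j" for r
  proof -
    obtain u w where uw: "r = x ^ lev j * u + y * w" "u \<in> S" "w \<in> S"
      using lev(2) r unfolding A_def by blast
    show ?thesis
    proof (cases "lev j = n")
      case True
      then have "r - y * (v * u + w) = 0" using uw xn by (simp add: algebra_simps)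
      then show ?thesis using uw v idealD(2)[OF I] by (metis add_in mult_in)
    next
      case False
      then have "\<not> I (Suc j) \<subseteq> A (Suc (lev j))"
        using lev_max[of "Suc (lev j)" "Suc j"] lev(1)[of j] j by auto
      then obtain r' where r': "r' \<in> I (Suc j)" "r' \<notin> A (Suc (lev j))" by blast
      obtain u' w' where uw': "r' = x ^ lev j * u' + y * w'" "u' \<in> S" "w' \<in> S"
        using lev(2)[of "Suc j"] r'(1) j unfolding A_def by auto
      \<comment> \<open>A nonunit coefficient would push \<open>r'\<close> one step further down,
        into \<open>A (Suc (lev j))\<close>. As a unit it lets \<open>r'\<close> cancel the leading
        part of any \<open>r\<close> in \<open>I j\<close>, up to a multiple of
        \<open>y\<close>.\<close>
      have "u' \<notin> nonunits S"
      proof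
        assume "u' \<in> nonunits S"
        then obtain a b where ab: "u' = x * a + y * b" "a \<in> S" "b \<in> S" unfolding gen by blast
        then have "r' = x ^ Suc (lev j) * a + y * (x ^ lev j * b + w')"
          using uw' by (simp add: algebra_simps)
        moreover have "x ^ lev j * b + w' \<in> S" using uw' ab xy by auto
        ultimately show False using r'(2) ab unfolding A_def by blast
      qed
      then have u': "inverse u' \<in> S" "u' \<noteq> 0" using unitD uw' by auto
      have "r - y * (w - u * inverse u' * w') = (u * inverse u') * r'"
        using uw uw' u' by (simp add: field_simps)
      moreover have "(u * inverse u') * r' \<in> I (Suc j)"
        using r' uw u' by (auto intro: idealD(4-8)[OF I])
      ultimately show ?thesis using uw uw' u' by (metis diff_in mult_in)
    qed
  qed
  \<comment> \<open>As \<open>y\<close> lies outside \<open>q\<close>, it can be moved into the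
    denominator \<open>s\<close>, so \<open>y * d\<close> in \<open>I j\<close> implies
    \<open>d\<close> in \<open>I j\<close>. Hence \<open>I j\<close> is contained in
    \<open>I (Suc j) + y I j\<close>, and Nakayama applies.\<close>
  have step: "\<exists>d\<in>I j. r - y * d \<in> I (Suc j)" if r: "r \<in> I j" for r
  proof -
    obtain d where d: "d \<in> S" "r - y * d \<in> I (Suc j)" using split[OF r] by blast
    have "r - (r - y * d) \<in> I j" using r d I_decr idealD(8)[OF I] by blast
    then have "y * d \<in> I j" by simp
    then obtain s e where "s \<in> S - q" "e \<in> S" "(s * y) * d = z ^ j * e"
      by (auto simp: I_def mult.assoc)
    moreover have "s * y \<in> S - q" using \<open>s \<in> S - q\<close> y xy qp by auto
    ultimately have "d \<in> I j" using d unfolding I_def by blast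
    then show ?thesis using d by blast
  qed
  then obtain g where g: "\<And>r. r \<in> I j \<Longrightarrow> g r \<in> I j \<and> r - y * g r \<in> I (Suc j)" by metis
  have zj: "z ^ j \<in> I j" using zS q1 by (auto simp: I_def intro!: bexI[of _ 1])
  define d where "d k = (g ^^ k) (z ^ j)" for k
  have dI: "d k \<in> I j" for k by (induction k) (use zj g in \<open>auto simp: d_def\<close>)
  have "d 0 \<in> I (Suc j)"
  proof (rule noetherian_absorb[OF noeth m I])
    show "d k \<in> S" for k using dI idealD(3)[OF I] by blast
    show "d k - y * d (Suc k) \<in> I (Suc j)" for k using g[OF dI[of k]] by (simp add: d_def)
  qed (use xm in auto)
  then obtain s e where s: "s \<in> S - q" "e \<in> S" "s * z ^ j = z ^ Suc j * e"
    by (auto simp: I_def d_def)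
  then have "s = z * e" using z(2) by simp
  then show False using s z by (auto intro: idealD(4-8)[OF qi])
qed

text \<open>Modulo \<open>y\<close>, every nonzero element is a unit times a power of
  \<open>x\<close>; otherwise it could be divided by \<open>x\<close> forever, which
  \<open>noetherian_absorb\<close> excludes. So a relation \<open>x * u = y * v\<close> with
  \<open>u\<close> not a multiple of \<open>y\<close> would make some power of \<open>x\<close> a
  multiple of \<open>y\<close>, against the principal ideal theorem. The prime \<open>q\<close> is
  how dimension at least 2 enters.\<close>

lemma (in field_subring) regular_paramsI:
  assumes noeth: "noetherian_ring (ring_on S)" and m: "ideal (nonunits S) (ring_on S)"
    and xy: "x \<in> S" "y \<in> S" and gen: "nonunits S = {x * u + y * v | u v. u \<in> S \<and> v \<in> S}"
    and q: "primeideal q (ring_on S)" "q \<noteq> {0}" "q \<noteq> nonunits S"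
  shows "regular_params S x y"
proof
  have gen': "nonunits S = {y * u + x * v | u v. u \<in> S \<and> v \<in> S}"
    unfolding gen by (auto simp: add.commute) 
  note pit = power_notin_principal[OF noeth m xy gen q]
  have pit': "y ^ n \<noteq> x * v" if "v \<in> S" for n v
    using power_notin_principal[OF noeth m xy(2,1) gen' q that] .
  show "x \<noteq> 0" using pit[of 0 1] by auto
  show "y \<noteq> 0" using pit'[of 0 1] by auto
  define N where "N = {y * w | w. w \<in> S}"
  have N: "ideal N (ring_on S)" unfolding N_def by (rule ideal_multiples[OF xy(2)])
  define good where "good w \<longleftrightarrow> (\<exists>i. \<exists>e\<in>S - nonunits S. \<exists>v\<in>S. w = x ^ i * e + y * v)" for w
  have good: "good w" if w: "w \<in> S" "w \<notin> N" for w
  proof (rule ccontr)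
    assume bad: "\<not> good w"
    define B where "B = {w \<in> S. w \<notin> N \<and> \<not> good w}"
    have "\<exists>w1\<in>B. w - x * w1 \<in> N" if "w \<in> B" for w
    proof -
      have wS: "w \<in> S" "w \<notin> N" "\<not> good w" using that by (auto simp: B_def)
      have "w = x ^ 0 * w + y * 0" by simp
      then have "w \<in> nonunits S" using wS zero_in unfolding good_def by blast
      then obtain u v where uv: "w = x * u + y * v" "u \<in> S" "v \<in> S" unfolding gen by blast
      have "u \<notin> N"
      proof
        assume "u \<in> N"
        then have "x * u \<in> N" by (rule idealD(5)[OF N _ xy(1)])
        moreover have "y * v \<in> N" using uv by (auto simp: N_def)
        ultimately show False using wS uv idealD(4)[OF N] by simp
      qed
      moreover have "\<not> good u"
      proof
        assume "good u"
        then obtain i e v' where "e \<in> S - nonunits S" "v' \<in> S" "u = x ^ i * e + y * v'"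
          unfolding good_def by blast
        then have "w = x ^ Suc i * e + y * (x * v' + v)" "x * v' + v \<in> S"
          using uv xy by (auto simp: algebra_simps)
        then show False using wS(3) \<open>e \<in> S - nonunits S\<close> unfolding good_def by blast
      qed
      moreover have "w - x * u \<in> N" using uv by (auto simp: N_def)
      ultimately show ?thesis using uv by (auto simp: B_def)
    qed
    then obtain g where g: "\<And>r. r \<in> B \<Longrightarrow> g r \<in> B \<and> r - x * g r \<in> N" by metis
    define d where "d k = (g ^^ k) w" for k
    have dB: "d k \<in> B" for k by (induction k) (use w bad g in \<open>auto simp: d_def B_def\<close>)
    have "x = x * 1 + y * 0" by simp
    then have xm: "x \<in> nonunits S" unfolding gen using one_in zero_in by blast
    have "d 0 \<in> N"
    proof (rule noetherian_absorb[OF noeth m N])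
      show "d k \<in> S" for k using dB by (auto simp: B_def)
      show "d k - x * d (Suc k) \<in> N" for k using g[OF dB[of k]] by (simp add: d_def)
    qed (use xm in auto)
    then show False using w by (simp add: d_def)
  qed
  show "\<exists>w\<in>S. u = y * w" if uv: "u \<in> S" "v \<in> S" "x * u = y * v" for u v
  proof (rule ccontr)
    assume "\<not> (\<exists>w\<in>S. u = y * w)"
    then have "good u" using good[OF uv(1)] unfolding N_def by blast
    then obtain i e v' where e: "e \<in> S - nonunits S" "v' \<in> S" "u = x ^ i * e + y * v'"
      unfolding good_def by blast
    have e': "inverse e \<in> S" "e \<noteq> 0" using unitD e by auto
    have "x ^ Suc i * e = y * (v - x * v')" using uv(3) e(3) by (simp add: algebra_simps)
    then have "x ^ Suc i = y * ((v - x * v') * inverse e)" using e' by (simp add: field_simps)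
    moreover have "(v - x * v') * inverse e \<in> S" using uv e e' xy by auto
    ultimately show False using pit by blast
  qed
qed (use xy gen in auto)

lemma subring_imp_field_subring:
  "subring D ring_of_type_algebra \<Longrightarrow> field_subring D"
proof -
  assume *: "subring D ring_of_type_algebra"
  interpret R: ring "ring_of_type_algebra :: 'a ring" by (rule ring_from_type_algebra)
  have inv: "\<ominus>\<^bsub>ring_of_type_algebra\<^esub> x = - x" for x :: 'a
    by (rule R.minus_equality) (auto simp: ring_of_type_algebra_def)
  show "field_subring D"
    by unfold_locales
       (use subringE[OF *] inv in \<open>auto simp: ring_of_type_algebra_def\<close>)
qed

text \<open>The middle member of a chain of three primes is neither zero nor maximal, which is
  exactly the prime that \<open>regular_paramsI\<close> asks for.\<close>

lemma regular_local_ring_2_params: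
  assumes "subring D ring_of_type_algebra" and reg: "regular_local_ring (ring_on D)"
    and dim: "krull_dim (ring_on D) = 2"
  shows "\<exists>x y. regular_params D x y"
proof -
  interpret field_subring D using assms(1) by (rule subring_imp_field_subring)
  have noeth: "noetherian_ring (ring_on D)" and loc: "local_ring (ring_on D)"
    using reg by (auto simp: regular_local_ring_def)
  note m = local_ring_imp_ideal_nonunits[OF loc noeth]
  obtain A where A: "A \<subseteq> D" "card A = 2" "nonunits D = Idl\<^bsub>ring_on D\<^esub> A"
    using reg dim by (auto simp: regular_local_ring_def max_ideal_eq_nonunits[OF m] numeral_eq_enat)
  obtain x y where "A = {x, y}" using A(2) by (auto simp: card_2_iff)
  then have xy: "x \<in> D" "y \<in> D" and Idl: "nonunits D = Idl\<^bsub>ring_on D\<^esub> {x, y}" using A by auto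
  interpret noetherian_ring "ring_on D" by fact
  define J where "J = {x * u + y * v | u v. u \<in> D \<and> v \<in> D}"
  have J: "ideal J (ring_on D)" unfolding J_def by (rule ideal_two_generated[OF xy])
  have "x = x * 1 + y * 0" "y = x * 0 + y * 1" by simp_all
  then have "{x, y} \<subseteq> J" unfolding J_def using one_in zero_in by blast
  then have "nonunits D \<subseteq> J" unfolding Idl by (rule genideal_minimal[OF J])
  moreover have "J \<subseteq> nonunits D"
  proof -
    have "{x, y} \<subseteq> nonunits D" unfolding Idl using xy by (intro genideal_self) auto
    then show ?thesis unfolding J_def by (auto intro: idealD(4-8)[OF m])
  qed
  ultimately have gen: "nonunits D = J" by blast
  obtain P where P: "prime_chain (ring_on D) P 2" using krull_dim_2D[OF dim] by blast
  have pr: "primeideal (P 0) (ring_on D)" "primeideal (P 1) (ring_on D)" "primeideal (P 2) (ring_on D)"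
    using P by (auto simp: prime_chain_def)
  have "P 0 \<subset> P (Suc 0)" "P 1 \<subset> P (Suc 1)" using P unfolding prime_chain_def by auto
  then have sub: "P 0 \<subset> P 1" "P 1 \<subset> P 2" by (simp_all add: numeral_2_eq_2)
  have "0 \<in> P 0" using pr(1) idealD(2)[of "P 0"] unfolding primeideal_iff by blast
  then have "P 1 \<noteq> {0}" using sub(1) by (metis psubsetE subset_singletonD empty_iff order_refl)
  moreover have "P 2 \<subseteq> nonunits D" using pr(3) ideal_subset_nonunits[of "P 2"] unfolding primeideal_iff by blast
  then have "P 1 \<noteq> nonunits D" using sub(2) by (metis psubset_subset_trans psubset_eq)
  ultimately have "regular_params D x y"
    by (intro regular_paramsI[OF noeth m xy _ pr(2)]) (use gen in \<open>simp_all add: J_def\<close>)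
  then show ?thesis by blast
qed


section \<open>Polynomials over a subring\<close>

lemma poly_overI: "(\<And>i. coeff p i \<in> A) \<Longrightarrow> p \<in> poly_over A"
  by (simp add: poly_over_def)

lemma poly_overD: "p \<in> poly_over A \<Longrightarrow> coeff p i \<in> A"
  by (simp add: poly_over_def)

lemma poly_over_mono: "A \<subseteq> B \<Longrightarrow> poly_over A \<subseteq> poly_over B"
  by (auto simp: poly_over_def)

text \<open>Three coefficient sets are kept apart so that the same rule serves for subrings, for
  ideals and for products of two powers of the maximal ideal.\<close>

lemma poly_over_mult:
  fixes A B C :: "'a::field set"
  assumes "p \<in> poly_over A" "q \<in> poly_over B" "0 \<in> C" "\<And>x y. x \<in> C \<Longrightarrow> y \<in> C \<Longrightarrow> x + y \<in> C"
    and "\<And>x y. x \<in> A \<Longrightarrow> y \<in> B \<Longrightarrow> x * y \<in> C"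
  shows "p * q \<in> poly_over C"
proof (rule poly_overI)
  have sum: "sum f I \<in> C" if "\<And>i. i \<in> I \<Longrightarrow> f i \<in> C" for f :: "nat \<Rightarrow> 'a" and I
    using that by (induction I rule: infinite_finite_induct) (auto intro: assms)
  show "coeff (p * q) i \<in> C" for i
    unfolding coeff_mult by (rule sum) (auto intro: assms poly_overD)
qed

lemma poly_eq_sum_lessThan:
  fixes p :: "'a::comm_ring_1 poly"
  assumes "\<And>i. i \<ge> n \<Longrightarrow> coeff p i = 0"
  shows "poly p x = (\<Sum>i<n. coeff p i * x ^ i)"
proof -
  have "poly p x = (\<Sum>i\<le>degree p. coeff p i * x ^ i)" by (rule poly_altdef)
  also have "\<dots> = (\<Sum>i<max n (Suc (degree p)). coeff p i * x ^ i)"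
    by (rule sum.mono_neutral_left) (auto simp: coeff_eq_0)
  also have "\<dots> = (\<Sum>i<n. coeff p i * x ^ i)"
    by (rule sum.mono_neutral_right) (auto simp: assms)
  finally show ?thesis .
qed

context field_subring begin

lemma poly_over_closed:
  shows "0 \<in> poly_over S" "1 \<in> poly_over S"
    and "p \<in> poly_over S \<Longrightarrow> q \<in> poly_over S \<Longrightarrow> p + q \<in> poly_over S"
    and "p \<in> poly_over S \<Longrightarrow> q \<in> poly_over S \<Longrightarrow> p - q \<in> poly_over S"
    and "p \<in> poly_over S \<Longrightarrow> - p \<in> poly_over S"
    and "p \<in> poly_over S \<Longrightarrow> q \<in> poly_over S \<Longrightarrow> p * q \<in> poly_over S"
    and "s \<in> S \<Longrightarrow> p \<in> poly_over S \<Longrightarrow> smult s p \<in> poly_over S"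
    and "s \<in> S \<Longrightarrow> Polynomial.monom s n \<in> poly_over S"
    and "s \<in> S \<Longrightarrow> [:s:] \<in> poly_over S"
    and "s \<in> S \<Longrightarrow> r \<in> S \<Longrightarrow> [:s, r:] \<in> poly_over S"
    and "p \<in> poly_over S \<Longrightarrow> poly_cutoff n p \<in> poly_over S"
proof -
  show "p \<in> poly_over S \<Longrightarrow> q \<in> poly_over S \<Longrightarrow> p * q \<in> poly_over S"
    by (rule poly_over_mult) auto
qed (auto simp: poly_over_def coeff_1 coeff_pCons coeff_poly_cutoff split: nat.split)

lemma poly_over_power: "p \<in> poly_over S \<Longrightarrow> p ^ n \<in> poly_over S"
  by (induction n) (auto intro: poly_over_closed)

lemma poly_over_ideal:
  assumes J: "ideal J (ring_on S)"
  shows "poly_over J \<subseteq> poly_over S" "0 \<in> poly_over J"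
    and "p \<in> poly_over J \<Longrightarrow> q \<in> poly_over J \<Longrightarrow> p + q \<in> poly_over J"
    and "p \<in> poly_over J \<Longrightarrow> q \<in> poly_over J \<Longrightarrow> p - q \<in> poly_over J"
    and "p \<in> poly_over J \<Longrightarrow> - p \<in> poly_over J"
    and "p \<in> poly_over S \<Longrightarrow> q \<in> poly_over J \<Longrightarrow> p * q \<in> poly_over J"
    and "p \<in> poly_over J \<Longrightarrow> q \<in> poly_over S \<Longrightarrow> p * q \<in> poly_over J"
proof -
  show "poly_over J \<subseteq> poly_over S" using poly_over_mono[OF idealD(1)[OF J]] .
  show "p \<in> poly_over S \<Longrightarrow> q \<in> poly_over J \<Longrightarrow> p * q \<in> poly_over J"
    by (rule poly_over_mult) (auto intro: idealD[OF J])
  show "p \<in> poly_over J \<Longrightarrow> q \<in> poly_over S \<Longrightarrow> p * q \<in> poly_over J"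
    by (rule poly_over_mult) (auto intro: idealD[OF J])
qed (auto simp: poly_over_def intro: idealD[OF J])

lemma ideal_self: "ideal S (ring_on S)"
  unfolding ideal_iff by auto

text \<open>Long division by a monic polynomial multiplies only by coefficients of the dividend, so
  quotient and remainder stay over the ideal \<open>J\<close>. The remainder is bounded by vanishing
  coefficients because \<open>degree r < degree p\<close> would fail for \<open>p = 1\<close>,
  \<open>r = 0\<close>.\<close>

lemma monic_division:
  assumes J: "ideal J (ring_on S)" and p: "p \<in> poly_over S" "lead_coeff p = 1"
    and h: "h \<in> poly_over J"
  shows "\<exists>q\<in>poly_over J. \<exists>r\<in>poly_over J. h = p * q + r \<and> (\<forall>i\<ge>degree p. coeff r i = 0)"
proof -
  have "\<exists>q\<in>poly_over J. \<exists>r\<in>poly_over J. h = p * q + r \<and> (\<forall>i\<ge>degree p. coeff r i = 0)"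
    if "h \<in> poly_over J" "\<And>i. i \<ge> n \<Longrightarrow> coeff h i = 0" for n h
    using that
  proof (induction n arbitrary: h)
    case 0
    then show ?case using poly_over_ideal(2)[OF J] by (intro bexI[of _ 0]) (auto simp: poly_eq_iff)
  next
    case (Suc n)
    show ?case
    proof (cases "Suc n \<le> degree p")
      case True
      then show ?thesis using Suc.prems poly_over_ideal(2)[OF J]
        by (intro bexI[of _ 0] bexI[of _ h]) auto
    next
      case False
      define k where "k = n - degree p"
      define c where "c = Polynomial.monom (coeff h n) k"
      have cJ: "c \<in> poly_over J"
        using poly_overD[OF Suc.prems(1)] idealD(2)[OF J] by (auto simp: c_def poly_over_def)
      define h' where "h' = h - c * p"
      have h'J: "h' \<in> poly_over J"
        unfolding h'_def using Suc.prems(1) cJ p by (intro poly_over_ideal[OF J])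
      have "coeff h' i = 0" if "i \<ge> n" for i
      proof (cases "i = n")
        case True
        then have "coeff h' i = coeff h n - coeff h n * coeff p (degree p)"
          using False by (simp add: h'_def c_def coeff_monom_mult k_def)
        then show ?thesis using p by simp
      next
        case ne: False
        then have "coeff p (i - k) = 0" using that False by (intro coeff_eq_0) (auto simp: k_def)
        then show ?thesis using that ne Suc.prems(2)[of i] by (simp add: h'_def c_def coeff_monom_mult)
      qed
      from Suc.IH[OF h'J this] obtain q r where qr: "q \<in> poly_over J" "r \<in> poly_over J"
        "h' = p * q + r" "\<forall>i\<ge>degree p. coeff r i = 0" by blast
      have "h = p * (q + c) + r" using qr(3) by (simp add: h'_def algebra_simps)
      moreover have "q + c \<in> poly_over J" using qr cJ by (intro poly_over_ideal[OF J])
      ultimately show ?thesis using qr by blast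
    qed
  qed
  from this[of h "Suc (degree h)"] h show ?thesis by (simp add: coeff_eq_0)
qed

text \<open>Cutting after the last unit coefficient removes only nonunits. The result represents the
  same polynomial over the residue field, and its leading coefficient can be inverted in
  \<open>S\<close>.\<close>

lemma unit_leading_truncation:
  assumes m: "ideal (nonunits S) (ring_on S)" and h: "h \<in> poly_over S" "h \<notin> poly_over (nonunits S)"
  shows "\<exists>h'\<in>poly_over S. h - h' \<in> poly_over (nonunits S) \<and> lead_coeff h' \<in> S - nonunits S
    \<and> degree h' \<le> degree h"
proof -
  define A where "A = {i. coeff h i \<notin> nonunits S}"
  have A: "A \<noteq> {}" "A \<subseteq> {..degree h}"
    using h(2) idealD(2)[OF m] by (auto simp: A_def poly_over_def intro: le_degree)
  then have fin: "finite A" by (rule_tac finite_subset) auto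
  define n where "n = Max A"
  have n: "n \<in> A" "n \<le> degree h" using Max_in[OF fin A(1)] A unfolding n_def by auto
  define h' where "h' = poly_cutoff (Suc n) h"
  have cn: "coeff h' n \<in> S - nonunits S" using n h by (auto simp: h'_def coeff_poly_cutoff A_def poly_over_def)
  then have "coeff h' n \<noteq> 0" using idealD(2)[OF m] by auto
  then have deg: "degree h' = n"
    by (intro antisym degree_le le_degree) (auto simp: h'_def coeff_poly_cutoff)
  have "h - h' \<in> poly_over (nonunits S)"
  proof (rule poly_overI)
    fix i
    show "coeff (h - h') i \<in> nonunits S"
    proof (cases "i \<le> n")
      case False
      then have "i \<notin> A" using Max_ge[OF fin] by (auto simp: n_def)
      then show ?thesis using False by (auto simp: A_def h'_def coeff_poly_cutoff)
    qed (simp add: h'_def coeff_poly_cutoff)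
  qed
  then show ?thesis using deg cn n h poly_over_closed(11)[OF h(1)] unfolding h'_def by metis
qed

text \<open>The leading coefficients of the two truncations multiply to a unit, which would be a
  coefficient of the reduced product.\<close>

lemma poly_over_nonunits_prime:
  assumes m: "ideal (nonunits S) (ring_on S)" and fg: "f \<in> poly_over S" "g \<in> poly_over S"
    and "f * g \<in> poly_over (nonunits S)"
  shows "f \<in> poly_over (nonunits S) \<or> g \<in> poly_over (nonunits S)"
proof (rule ccontr)
  assume "\<not> ?thesis"
  then obtain f' g' where
    f: "f' \<in> poly_over S" "f - f' \<in> poly_over (nonunits S)" "lead_coeff f' \<in> S - nonunits S" and
    g: "g' \<in> poly_over S" "g - g' \<in> poly_over (nonunits S)" "lead_coeff g' \<in> S - nonunits S"
    using unit_leading_truncation[OF m] fg by metis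
  have "f * g - f * (g - g') - (f - f') * g' \<in> poly_over (nonunits S)"
    using poly_over_ideal(6)[OF m fg(1) g(2)] poly_over_ideal(7)[OF m f(2) g(1)] assms(4)
    by (intro poly_over_ideal(4)[OF m])
  then have "f' * g' \<in> poly_over (nonunits S)" by (simp add: algebra_simps)
  then have "coeff (f' * g') (degree f' + degree g') \<in> nonunits S" by (rule poly_overD)
  then have "lead_coeff f' * lead_coeff g' \<in> nonunits S" by (simp add: coeff_mult_degree_sum)
  then show False using unit_mult[OF f(3) g(3)] by blast
qed

lemma poly_eval_in: "h \<in> poly_over S \<Longrightarrow> s \<in> S \<Longrightarrow> poly h s \<in> S"
  unfolding poly_altdef by (auto intro: poly_overD)

lemma poly_eval_ideal:
  assumes "ideal J (ring_on S)" "h \<in> poly_over J" "s \<in> S"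
  shows "poly h s \<in> J"
proof -
  have "(\<Sum>i\<in>I. coeff h i * s ^ i) \<in> J" for I
    using assms by (induction I rule: infinite_finite_induct)
      (auto intro: idealD(2)[OF assms(1)] idealD(4,6)[OF assms(1)] poly_overD)
  then show ?thesis by (simp add: poly_altdef)
qed

end

section \<open>Regular parameters and values of polynomials at \<open>y / x\<close>\<close>

context regular_params begin

lemma x_nonunit [simp, intro]: "x \<in> nonunits S" and y_nonunit [simp, intro]: "y \<in> nonunits S"
proof -
  have "x = x * 1 + y * 0" "y = x * 0 + y * 1" by simp_all
  then show "x \<in> nonunits S" "y \<in> nonunits S" unfolding nonunits_eq using one_in zero_in by blast+
qed

lemma ideal_nonunits: "ideal (nonunits S) (ring_on S)"
  unfolding nonunits_eq by (rule ideal_two_generated[OF x_in y_in])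

lemmas max_ideal = max_ideal_eq_nonunits[OF ideal_nonunits]
lemmas nonunits_idealD = idealD[OF ideal_nonunits]

lemma swap_params: "regular_params S y x"
proof
  show "nonunits S = {y * u + x * v | u v. u \<in> S \<and> v \<in> S}"
    unfolding nonunits_eq by (auto simp: add.commute)
  fix u v assume uv: "u \<in> S" "v \<in> S" "y * u = x * v"
  then obtain w where "w \<in> S" "v = y * w" using regular[of v u] by auto
  then show "\<exists>w\<in>S. u = x * w" using uv y_nz by auto
qed (use x_nz y_nz in auto)

lemma change_first_param:
  assumes u: "u \<in> S - nonunits S" and v: "v \<in> S"
  shows "regular_params S (u * x + v * y) y"
proof
  have iu: "inverse u \<in> S" "u \<noteq> 0" using unitD[OF u] by auto
  show "u * x + v * y \<in> S" "y \<in> S" "y \<noteq> 0" using u v y_nz by auto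
  show "u * x + v * y \<noteq> 0"
  proof
    assume "u * x + v * y = 0"
    then have "x * u = y * (- v)" by (simp add: algebra_simps add_eq_0_iff)
    then obtain w where "w \<in> S" "u = y * w" using regular[of u "- v"] u v by auto
    then show False using u nonunits_mult[of w y] by (simp add: mult.commute)
  qed
  show "nonunits S = {(u * x + v * y) * r + y * s |r s. r \<in> S \<and> s \<in> S}" (is "_ = ?R")
  proof
    show "?R \<subseteq> nonunits S"
      using u v by (force intro: nonunits_idealD(4-6))
    show "nonunits S \<subseteq> ?R"
    proof
      fix c assume "c \<in> nonunits S"
      then obtain r s where rs: "c = x * r + y * s" "r \<in> S" "s \<in> S" unfolding nonunits_eq by blast
      then have "c = (u * x + v * y) * (inverse u * r) + y * (s - v * inverse u * r)"
        using iu by (simp add: field_simps)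
      moreover have "inverse u * r \<in> S" "s - v * inverse u * r \<in> S" using rs iu v by auto
      ultimately show "c \<in> ?R" by blast
    qed
  qed
  fix r s assume rs: "r \<in> S" "s \<in> S" "(u * x + v * y) * r = y * s"
  then have "x * (u * r) = y * (s - v * r)" by (simp add: algebra_simps)
  then obtain w where w: "w \<in> S" "u * r = y * w" using regular[of "u * r" "s - v * r"] rs u v by auto
  then have "r = y * (inverse u * w)" using iu by (simp add: field_simps)
  then show "\<exists>w\<in>S. r = y * w" using w iu by blast
qed

lemma y_power_regular: "u \<in> S \<Longrightarrow> v \<in> S \<Longrightarrow> y ^ n * u = x * v \<Longrightarrow> \<exists>w\<in>S. u = x * w"
proof (induction n arbitrary: u)
  case 0
  then show ?case by auto
next
  case (Suc n)
  interpret sw: regular_params S y x by (rule swap_params)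
  have "y ^ n * (y * u) = x * v" using Suc.prems by (simp add: mult_ac)
  then obtain w where "w \<in> S" "y * u = x * w" using Suc.IH[of "y * u"] Suc.prems by auto
  then show ?case using sw.regular Suc.prems by blast
qed

lemma clear_denominators:
  assumes "h \<in> poly_over S" "\<And>i. i > n \<Longrightarrow> coeff h i = 0"
  shows "x ^ n * poly h (y / x) = (\<Sum>i\<le>n. coeff h i * y ^ i * x ^ (n - i))"
proof -
  have "poly h (y / x) = (\<Sum>i<Suc n. coeff h i * (y / x) ^ i)"
    by (rule poly_eq_sum_lessThan) (use assms in auto)
  then have "x ^ n * poly h (y / x) = (\<Sum>i\<le>n. x ^ n * (coeff h i * (y / x) ^ i))"
    by (simp add: sum_distrib_left lessThan_Suc_atMost)
  also have "\<dots> = (\<Sum>i\<le>n. coeff h i * y ^ i * x ^ (n - i))"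
    by (rule sum.cong) (auto simp: x_nz power_diff field_simps)
  finally show ?thesis .
qed

lemma clear_denominators_in:
  assumes "h \<in> poly_over S" "\<And>i. i > n \<Longrightarrow> coeff h i = 0"
  shows "x ^ n * poly h (y / x) \<in> S"
proof -
  have "(\<Sum>i\<le>n. coeff h i * y ^ i * x ^ (n - i)) \<in> S"
    by (intro sum_in mult_in power_in poly_overD[OF assms(1)]) auto
  then show ?thesis using clear_denominators[of h n] assms by simp
qed

text \<open>The exceptional fibre of the chart is therefore a full affine line over the residue field.\<close>

lemma poly_ratio_zero_imp_nonunit_coeffs:
  assumes "h \<in> poly_over S" "poly h (y / x) = 0"
  shows "h \<in> poly_over (nonunits S)"
proof -
  have "h \<in> poly_over (nonunits S)"
    if "h \<in> poly_over S" "poly h (y / x) = 0" "\<And>i. i \<ge> n \<Longrightarrow> coeff h i = 0" for n h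
    using that
  proof (induction n arbitrary: h)
    case 0
    then show ?case by (auto simp: poly_over_def)
  next
    case (Suc n)
    define c where "c = coeff h n"
    have cS: "c \<in> S" using Suc.prems(1) by (auto simp: c_def intro: poly_overD)
    show ?case
    proof (cases n)
      case 0
      then have "poly h (y / x) = c" using poly_eq_sum_lessThan[of "Suc 0" h] Suc.prems(3) by (simp add: c_def)
      then have "coeff h i = 0" for i
        using Suc.prems(2,3) 0 by (cases i) (auto simp: c_def)
      then show ?thesis by (auto simp: poly_over_def)
    next
      case n: (Suc k)
      have "0 = (\<Sum>i\<le>n. coeff h i * y ^ i * x ^ (n - i))"
        using clear_denominators[OF Suc.prems(1), of n] Suc.prems(2,3) by simp
      also have "\<dots> = (\<Sum>i\<le>k. coeff h i * y ^ i * x ^ (n - i)) + c * y ^ n"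
        by (simp add: n c_def)
      also have "(\<Sum>i\<le>k. coeff h i * y ^ i * x ^ (n - i)) = x * (\<Sum>i\<le>k. coeff h i * y ^ i * x ^ (k - i))"
        unfolding sum_distrib_left by (rule sum.cong) (auto simp: n Suc_diff_le)
      finally have "y ^ n * c = x * - (\<Sum>i\<le>k. coeff h i * y ^ i * x ^ (k - i))"
        by (simp add: algebra_simps eq_neg_iff_add_eq_0)
      moreover have "- (\<Sum>i\<le>k. coeff h i * y ^ i * x ^ (k - i)) \<in> S"
        by (intro uminus_in sum_in mult_in power_in poly_overD[OF Suc.prems(1)]) auto
      ultimately obtain w where w: "w \<in> S" "c = x * w" using y_power_regular[OF cS] by blast
      \<comment> \<open>Since \<open>c = x * w\<close>, the term \<open>c X^n\<close> has at
        \<open>y / x\<close> the same value as \<open>y * w X^k\<close> with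
        \<open>k = n - 1\<close>. The exchange lowers the degree and alters coefficients only by
        nonunits.\<close>
      define h' where "h' = h - Polynomial.monom c n + Polynomial.monom (y * w) k"
      have "h' \<in> poly_over (nonunits S)"
      proof (rule Suc.IH)
        show "h' \<in> poly_over S" unfolding h'_def using Suc.prems(1) cS w by (intro poly_over_closed) auto
        show "poly h' (y / x) = 0"
          using Suc.prems(2) w x_nz by (simp add: h'_def poly_monom n)
        show "coeff h' i = 0" if "i \<ge> n" for i
          using that n Suc.prems(3)[of i] by (auto simp: h'_def c_def)
      qed
      then have *: "coeff h' i \<in> nonunits S" for i by (rule poly_overD)
      show ?thesis
      proof (rule poly_overI)
        fix i
        have "coeff h i = coeff h' i + (if i = n then x * w else 0) - (if i = k then y * w else 0)"
          by (auto simp: h'_def w)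
        then show "coeff h i \<in> nonunits S"
          using * w by (auto intro!: nonunits_idealD(4,8) nonunits_idealD(6))
      qed
    qed
  qed
  from this[of h "Suc (degree h)"] assms show ?thesis by (simp add: coeff_eq_0)
qed

end


section \<open>Structure of local quadratic transforms\<close>

lemma prime_chain_subset:
  assumes "prime_chain R P n" "i \<le> j" "j \<le> n"
  shows "P i \<subseteq> P j"
  using assms(2,3)
proof (induction j rule: dec_induct)
  case (step k)
  then show ?case using assms(1) unfolding prime_chain_def by (meson Suc_le_lessD less_imp_le_nat psubset_imp_subset subset_trans)
qed simp

lemma prime_chain_2_extend:
  assumes "prime_chain R P 2" "primeideal Q R" "P 2 \<subset> Q"
  shows "prime_chain R (P(3 := Q)) 3"
  unfolding prime_chain_def
proof (intro conjI allI impI)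
  fix i :: nat
  show "primeideal ((P(3 := Q)) i) R" if "i \<le> 3"
    using assms that by (auto simp: prime_chain_def)
  show "(P(3 := Q)) i \<subset> (P(3 := Q)) (Suc i)" if "i < 3"
  proof (cases "i = 2")
    case True
    then show ?thesis using assms by simp
  next
    case False
    then show ?thesis using assms that by (auto simp: prime_chain_def)
  qed
qed

lemma krull_dim_le_2_iff: "krull_dim R \<le> 2 \<longleftrightarrow> (\<forall>P. \<not> prime_chain R P 3)"
  using krull_dim_le_iff[of R 2] by (simp add: numeral_eq_enat)

context field_subring begin

lemma primeideal_contract:
  assumes B: "field_subring B" "S \<subseteq> B" and Q: "primeideal Q (ring_on B)"
  shows "primeideal (Q \<inter> S) (ring_on S)"
proof -
  interpret B: field_subring B by fact
  have Q: "ideal Q (ring_on B)" "1 \<notin> Q" "\<And>a b. a \<in> B \<Longrightarrow> b \<in> B \<Longrightarrow> a * b \<in> Q \<Longrightarrow> a \<in> Q \<or> b \<in> Q"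
    using Q unfolding B.primeideal_iff by blast+
  show ?thesis
    unfolding primeideal_iff ideal_iff
    using Q(2,3) B(2) by (auto intro: B.idealD(2-5)[OF Q(1)])
qed

context
  fixes P assumes P: "primeideal P (ring_on S)"
begin

lemma prime_D: "ideal P (ring_on S)" "1 \<notin> P" "a \<in> S \<Longrightarrow> b \<in> S \<Longrightarrow> a * b \<in> P \<Longrightarrow> a \<in> P \<or> b \<in> P"
  using P unfolding primeideal_iff by blast+

lemma prime_compl_nz: "s \<in> S - P \<Longrightarrow> s \<noteq> 0"
  using idealD(2)[OF prime_D(1)] by blast

lemma prime_compl_mult: "s \<in> S - P \<Longrightarrow> r \<in> S - P \<Longrightarrow> s * r \<in> S - P"
  using prime_D(3) by auto

lemma localizationI: "x \<in> S \<Longrightarrow> s \<in> S - P \<Longrightarrow> x / s \<in> localization_at S P"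
  by (auto simp: localization_at_def)

lemma field_subring_localization: "field_subring (localization_at S P)"
proof
  have one: "1 \<in> S - P" using prime_D(2) by auto
  show "0 \<in> localization_at S P" "1 \<in> localization_at S P"
    using localizationI[OF zero_in one] localizationI[OF one_in one] by simp_all
  fix u v assume "u \<in> localization_at S P" "v \<in> localization_at S P"
  then obtain x s y r where *: "u = x / s" "v = y / r" "x \<in> S" "y \<in> S" "s \<in> S - P" "r \<in> S - P"
    by (auto simp: localization_at_def)
  have "u + v = (x * r + y * s) / (s * r)" "u * v = (x * y) / (s * r)" "- u = (- x) / s"
    using * prime_compl_nz by (auto simp: field_simps)
  moreover have "x * r + y * s \<in> S" "x * y \<in> S" "- x \<in> S" using * by auto
  ultimately show "u + v \<in> localization_at S P" "u * v \<in> localization_at S P" "- u \<in> localization_at S P"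
    using localizationI prime_compl_mult * by metis+
qed

lemma subset_localization: "S \<subseteq> localization_at S P"
  using localizationI[of _ 1] prime_D(2) by force

lemma nonunits_localization: "nonunits (localization_at S P) = {x / s | x s. x \<in> P \<and> s \<in> S - P}"
proof
  show "{x / s | x s. x \<in> P \<and> s \<in> S - P} \<subseteq> nonunits (localization_at S P)"
  proof clarify
    fix x s assume xs: "x \<in> P" "s \<in> S" "s \<notin> P"
    have "x / s * u \<noteq> 1" if u: "u \<in> localization_at S P" for u
    proof
      assume eq: "x / s * u = 1"
      obtain y r where yr: "u = y / r" "y \<in> S" "r \<in> S - P" using u by (auto simp: localization_at_def)
      then have "x * y = s * r" using eq prime_compl_nz xs by (auto simp: field_simps)
      moreover have "x * y \<in> P" using xs yr by (auto intro: idealD(6)[OF prime_D(1)])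
      ultimately show False using prime_compl_mult[of s r] xs yr by auto
    qed
    moreover have "x / s \<in> localization_at S P" using xs idealD(3)[OF prime_D(1)] by (auto intro: localizationI)
    ultimately show "x / s \<in> nonunits (localization_at S P)" unfolding nonunits_def by blast
  qed
  show "nonunits (localization_at S P) \<subseteq> {x / s | x s. x \<in> P \<and> s \<in> S - P}"
  proof
    fix u assume u: "u \<in> nonunits (localization_at S P)"
    then obtain x s where xs: "u = x / s" "x \<in> S" "s \<in> S - P"
      using nonunits_subset by (fastforce simp: localization_at_def)
    have "x \<in> P"
    proof (rule ccontr)
      assume "x \<notin> P"
      then have "s / x \<in> localization_at S P" "u * (s / x) = 1"
        using xs prime_compl_nz by (auto intro: localizationI simp: field_simps)
      then show False using u unfolding nonunits_def by blast
    qed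
    then show "u \<in> {x / s | x s. x \<in> P \<and> s \<in> S - P}" using xs by blast
  qed
qed

lemma nonunits_localization_iff: "x \<in> S \<Longrightarrow> x \<in> nonunits (localization_at S P) \<longleftrightarrow> x \<in> P"
proof
  assume x: "x \<in> S" "x \<in> nonunits (localization_at S P)"
  then obtain y s where ys: "x = y / s" "y \<in> P" "s \<in> S - P" unfolding nonunits_localization by blast
  then have "x * s \<in> P" using prime_compl_nz by (auto simp: field_simps)
  then show "x \<in> P" using prime_D(3) x ys by blast
next
  assume "x \<in> P"
  moreover have "x = x / 1" "1 \<in> S - P" using prime_D(2) by auto
  ultimately show "x \<in> nonunits (localization_at S P)" unfolding nonunits_localization by blast
qed

text \<open>A chain of four primes of the localization contracts to a strict chain inside
  \<open>P\<close>. Its first three members followed by \<open>P\<close> itself contradict the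
  height of \<open>P\<close>.\<close>

lemma krull_dim_localization_le_2:
  assumes "height (ring_on S) P = 2" shows "krull_dim (ring_on (localization_at S P)) \<le> 2"
  unfolding krull_dim_le_2_iff
proof (intro allI notI)
  let ?T = "localization_at S P"
  fix Q assume Q: "prime_chain (ring_on ?T) Q 3"
  interpret T: field_subring ?T by (rule field_subring_localization)
  have Qp: "primeideal (Q i) (ring_on ?T)" if "i \<le> 3" for i using Q that by (auto simp: prime_chain_def)
  have Qi: "ideal (Q i) (ring_on ?T)" "1 \<notin> Q i" if "i \<le> 3" for i
    using Qp[OF that] unfolding T.primeideal_iff by blast+
  define Q' where "Q' i = Q i \<inter> S" for i
  have pr: "primeideal (Q' i) (ring_on S)" if "i \<le> 3" for i
    unfolding Q'_def by (rule primeideal_contract[OF T.field_subring_axioms subset_localization Qp[OF that]])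
  have strict: "Q' i \<subset> Q' (Suc i)" if i: "i < 3" for i
  proof
    have "Q i \<subset> Q (Suc i)" using Q i by (auto simp: prime_chain_def)
    then show "Q' i \<subseteq> Q' (Suc i)" by (auto simp: Q'_def)
    obtain u where u: "u \<in> Q (Suc i)" "u \<notin> Q i" using \<open>Q i \<subset> Q (Suc i)\<close> by blast
    have "u \<in> ?T" using u(1) T.idealD(3)[OF Qi(1)[of "Suc i"]] i by auto
    then obtain x s where xs: "u = x / s" "x \<in> S" "s \<in> S - P" by (auto simp: localization_at_def)
    have "s \<in> ?T" "1 / s \<in> ?T" using xs subset_localization localizationI[of 1 s] by auto
    then have "u * s \<in> Q (Suc i)" using u(1) i by (auto intro: T.idealD(6)[OF Qi(1)])
    then have "x \<in> Q' (Suc i)" using xs prime_compl_nz by (auto simp: Q'_def)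
    moreover have "x \<notin> Q' i"
    proof
      assume "x \<in> Q' i"
      then have "x * (1 / s) \<in> Q i" using i \<open>1 / s \<in> ?T\<close> by (intro T.idealD(6)[OF Qi(1)]) (auto simp: Q'_def)
      then show False using u xs by simp
    qed
    ultimately show "Q' i \<noteq> Q' (Suc i)" by blast
  qed
  have "Q' 3 \<subseteq> P"
  proof
    fix z assume "z \<in> Q' 3"
    then have "z \<in> nonunits ?T" "z \<in> S" using T.ideal_subset_nonunits[OF Qi[of 3]] by (auto simp: Q'_def)
    then show "z \<in> P" using nonunits_localization_iff by blast
  qed
  moreover have "Q' 2 \<subset> Q' 3" using strict[of 2] by simp
  ultimately have "Q' 2 \<subset> P" by blast
  moreover have "prime_chain (ring_on S) Q' 2" using pr strict by (auto simp: prime_chain_def)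
  ultimately have "prime_chain (ring_on S) (Q'(3 := P)) 3" using prime_chain_2_extend P by blast
  then show False using height_2D(2)[OF assms] by fastforce
qed

end

end

text \<open>
  \<open>T\<close> is the local ring, on the chart with coordinate \<open>y / x\<close> and exceptional parameter \<open>x\<close>, of the closed
  point of the exceptional line at which the reduction of \<open>p\<close> modulo the maximal ideal vanishes.
\<close>

locale quadratic_transform = regular_params S x y for S :: "'a::field set" and x y +
  fixes T :: "'a set" and p :: "'a poly"
  assumes p_in: "p \<in> poly_over S" and monic: "lead_coeff p = 1"
    and T_params: "regular_params T x (poly p (y / x))"
    and S_subset: "S \<subseteq> T" and ratio_in: "y / x \<in> T"
    and fraction: "z \<in> T \<Longrightarrow> \<exists>h\<in>poly_over S. \<exists>k\<in>poly_over S.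
          poly k (y / x) \<notin> nonunits T \<and> z = poly h (y / x) / poly k (y / x)"
    and kernel: "h \<in> poly_over S \<Longrightarrow> poly h (y / x) \<in> nonunits T \<Longrightarrow>
          \<exists>q\<in>poly_over S. \<exists>r\<in>poly_over (nonunits S). h = p * q + r"
    and invert: "h \<in> poly_over S \<Longrightarrow> poly h (y / x) \<notin> nonunits T \<Longrightarrow>
          \<exists>v\<in>poly_over S. poly h (y / x) * poly v (y / x) - 1 \<in> nonunits T"
    and minimal: "l \<in> poly_over S \<Longrightarrow> lead_coeff l = 1 \<Longrightarrow> poly l (y / x) \<in> nonunits T \<Longrightarrow>
          degree p \<le> degree l"

section \<open>The affine chart of the blow-up and its local rings\<close>

context regular_params begin

definition chart :: "'a set" where
  "chart = {poly h (y / x) | h. h \<in> poly_over S}"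

lemma chartI: "h \<in> poly_over S \<Longrightarrow> poly h (y / x) \<in> chart"
  by (auto simp: chart_def)

lemma field_subring_chart: "field_subring chart"
proof
  show "0 \<in> chart" "1 \<in> chart" using chartI[of 0] chartI[of 1] poly_over_closed(1,2) by simp_all
  fix a b assume "a \<in> chart" "b \<in> chart"
  then obtain h k where *: "h \<in> poly_over S" "k \<in> poly_over S" "a = poly h (y / x)" "b = poly k (y / x)"
    by (auto simp: chart_def)
  show "a + b \<in> chart" "a * b \<in> chart" "- a \<in> chart"
    using chartI[of "h + k"] chartI[of "h * k"] chartI[of "- h"] * poly_over_closed(3,5,6) by simp_all
qed

lemma subset_chart: "S \<subseteq> chart" and ratio_chart: "y / x \<in> chart"
  using chartI[of "[:_:]"] chartI[of "[:0, 1:]"] poly_over_closed(9,10) by (auto simp del: times_divide_eq_right)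

lemma nonunits_factor: "s \<in> nonunits S \<Longrightarrow> \<exists>b\<in>chart. s = x * b"
proof -
  interpret B: field_subring chart by (rule field_subring_chart)
  assume "s \<in> nonunits S"
  then obtain u v where uv: "s = x * u + y * v" "u \<in> S" "v \<in> S" unfolding nonunits_eq by blast
  then have "s = x * (u + (y / x) * v)" using x_nz by (simp add: field_simps)
  moreover have "u + (y / x) * v \<in> chart" using uv subset_chart ratio_chart by blast
  ultimately show ?thesis by blast
qed

lemma blowup_chart_eq: "blowup_chart S x = chart"
proof
  interpret B: field_subring chart by (rule field_subring_chart)
  have neg: "\<ominus>\<^bsub>ring_of_type_algebra\<^esub> z = - z" for z :: 'a
  proof -
    interpret R: ring "ring_of_type_algebra :: 'a ring" by (rule ring_from_type_algebra)
    show ?thesis by (rule R.minus_equality) (auto simp: ring_of_type_algebra_def)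
  qed
  let ?G = "S \<union> {z / x | z. z \<in> nonunits S}"
  have eq: "blowup_chart S x = generate_ring ring_of_type_algebra ?G"
    by (simp add: blowup_chart_def max_ideal)
  show "blowup_chart S x \<subseteq> chart"
    unfolding eq
  proof
    fix z assume "z \<in> generate_ring ring_of_type_algebra ?G"
    then show "z \<in> chart"
    proof induction
      case (incl h)
      then show ?case using subset_chart nonunits_factor x_nz by fastforce
    qed (use neg in \<open>auto simp: ring_of_type_algebra_def\<close>)
  qed
  have G: "field_subring (blowup_chart S x)"
    unfolding eq
    by unfold_locales
      (use generate_ring.intros[where R = ring_of_type_algebra and H = ?G] neg in
        \<open>auto simp: ring_of_type_algebra_def intro: generate_ring.incl\<close>)
  then interpret G: field_subring "blowup_chart S x" .
  have t: "y / x \<in> blowup_chart S x" unfolding eq by (rule generate_ring.incl) auto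
  have "S \<subseteq> blowup_chart S x" unfolding eq by (auto intro: generate_ring.incl)
  then have "poly_over S \<subseteq> poly_over (blowup_chart S x)" by (rule poly_over_mono)
  then show "chart \<subseteq> blowup_chart S x"
    using G.poly_eval_in[OF _ t] unfolding chart_def by blast
qed

text \<open>A power of \<open>x\<close> moves any element of the chart into \<open>S\<close>, so
  chains of primes avoiding \<open>x\<close> contract strictly. If \<open>x\<close> were not in
  \<open>P\<close>, the contracted chain of three primes would avoid \<open>x\<close> and could be
  prolonged by \<open>nonunits S\<close>, exceeding dimension 2.\<close>

lemma x_in_height_2_prime:
  assumes P: "primeideal P (ring_on chart)" "height (ring_on chart) P = 2"
    and dim: "krull_dim (ring_on S) \<le> 2"
  shows "x \<in> P"
proof (rule ccontr)
  assume x: "x \<notin> P"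
  interpret B: field_subring chart by (rule field_subring_chart)
  obtain Q where Q: "prime_chain (ring_on chart) Q 2" "Q 2 = P"
    using height_2D(1)[OF P(2)] by blast
  have Qp: "primeideal (Q i) (ring_on chart)" if "i \<le> 2" for i using Q that by (auto simp: prime_chain_def)
  have xQ: "x \<notin> Q i" if "i \<le> 2" for i
    using prime_chain_subset[OF Q(1) that] Q(2) x by blast
  define Q' where "Q' i = Q i \<inter> S" for i
  have pr: "primeideal (Q' i) (ring_on S)" if "i \<le> 2" for i
    unfolding Q'_def by (rule primeideal_contract[OF field_subring_chart subset_chart Qp[OF that]])
  have strict: "Q' i \<subset> Q' (Suc i)" if i: "i < 2" for i
  proof
    have *: "Q i \<subset> Q (Suc i)" using Q i by (auto simp: prime_chain_def)
    then show "Q' i \<subseteq> Q' (Suc i)" by (auto simp: Q'_def)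
    obtain u where u: "u \<in> Q (Suc i)" "u \<notin> Q i" using * by blast
    have i2: "i \<le> 2" "Suc i \<le> 2" using i by auto
    note Qd = B.prime_D[OF Qp[OF i2(1)]] and Qd' = B.prime_D[OF Qp[OF i2(2)]]
    have uB: "u \<in> chart" using u(1) B.idealD(3)[OF Qd'(1)] by blast
    then obtain h where h: "h \<in> poly_over S" "u = poly h (y / x)" by (auto simp: chart_def)
    have xB: "x ^ n \<in> chart" for n using subset_chart by auto
    have "x ^ degree h * u \<in> S" unfolding h(2)
      by (rule clear_denominators_in[OF h(1)]) (simp add: coeff_eq_0)
    moreover have "x ^ degree h * u \<in> Q (Suc i)" by (rule B.idealD(5)[OF Qd'(1) u(1) xB])
    moreover have "x ^ n * u \<notin> Q i" for n
    proof (induction n)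
      case (Suc n)
      then show ?case using Qd(3)[of x "x ^ n * u"] xQ[OF i2(1)] uB xB[of n] subset_chart by (auto simp: mult.assoc)
    qed (use u in simp)
    ultimately show "Q' i \<noteq> Q' (Suc i)" unfolding Q'_def by blast
  qed
  have Q2: "Q' 2 \<subset> nonunits S"
  proof
    show "Q' 2 \<subseteq> nonunits S" using pr[of 2] ideal_subset_nonunits prime_D by blast
    show "Q' 2 \<noteq> nonunits S" using x_nonunit x Q(2) by (auto simp: Q'_def)
  qed
  have "primeideal (nonunits S) (ring_on S)"
    using maximalideal_nonunits[OF ideal_nonunits] maximalideal_imp_primeideal by blast
  moreover have "prime_chain (ring_on S) Q' 2" using pr strict by (auto simp: prime_chain_def)
  ultimately have "prime_chain (ring_on S) (Q'(3 := nonunits S)) 3" using prime_chain_2_extend Q2 by blast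
  then show False using dim krull_dim_le_2_iff by blast
qed

text \<open>The polynomial \<open>p\<close> is a monic one of least degree whose value at
  \<open>y / x\<close> lies in \<open>P\<close>; modulo the maximal ideal it is the minimal
  polynomial of the residue of \<open>y / x\<close>.\<close>

lemma chart_localization:
  assumes P: "maximalideal P (ring_on chart)" and xP: "x \<in> P"
  shows "\<exists>p. quadratic_transform S x y (localization_at chart P) p"
proof -
  interpret B: field_subring chart by (rule field_subring_chart)
  let ?t = "y / x" and ?T = "localization_at chart P"
  have pr: "primeideal P (ring_on chart)" by (rule B.maximalideal_imp_primeideal[OF P])
  note Pd = B.prime_D[OF pr] and Pid = B.idealD[OF B.prime_D(1)[OF pr]]
  interpret T: field_subring ?T by (rule B.field_subring_localization[OF pr])
  have BT: "chart \<subseteq> ?T" by (rule B.subset_localization[OF pr])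
  have ST: "S \<subseteq> ?T" using BT subset_chart by blast
  have nonunit_iff: "b \<in> nonunits ?T \<longleftrightarrow> b \<in> P" if "b \<in> chart" for b
    by (rule B.nonunits_localization_iff[OF pr that])
  have mP: "poly h ?t \<in> P" if h: "h \<in> poly_over (nonunits S)" for h
  proof -
    have "nonunits S \<subseteq> P" using nonunits_factor xP Pid(6) by blast
    then have "h \<in> poly_over P" using h poly_over_mono by blast
    then show ?thesis by (rule B.poly_eval_ideal[OF Pd(1) _ ratio_chart])
  qed
  have mx: "\<exists>b\<in>chart. poly h ?t = x * b" if h: "h \<in> poly_over (nonunits S)" for h
  proof -
    define J where "J = {x * b | b. b \<in> chart}"
    have "ideal J (ring_on chart)"
      unfolding J_def using subset_chart by (blast intro: B.ideal_multiples)
    moreover have "nonunits S \<subseteq> J" using nonunits_factor by (auto simp: J_def)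
    then have "h \<in> poly_over J" using h poly_over_mono by blast
    ultimately have "poly h ?t \<in> J" using B.poly_eval_ideal ratio_chart by blast
    then show ?thesis by (auto simp: J_def)
  qed
  define K where "K = {h \<in> poly_over S. poly h ?t \<in> P}"
  have monic_K: "\<exists>l\<in>K. lead_coeff l = 1 \<and> degree l \<le> degree h"
    if h: "h \<in> K" "h \<notin> poly_over (nonunits S)" for h
  proof -
    have hS: "h \<in> poly_over S" using h(1) by (simp add: K_def)
    obtain h' where h': "h' \<in> poly_over S" "h - h' \<in> poly_over (nonunits S)"
        "lead_coeff h' \<in> S - nonunits S" "degree h' \<le> degree h"
      using unit_leading_truncation[OF ideal_nonunits hS h(2)] by blast
    define l where "l = smult (inverse (lead_coeff h')) h'"
    have iu: "inverse (lead_coeff h') \<in> S" "lead_coeff h' \<noteq> 0" using unitD[OF h'(3)] by auto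
    have "poly h' ?t \<in> P" using Pid(8)[OF _ mP[OF h'(2)], of "poly h ?t"] h(1) by (simp add: K_def)
    then have "poly l ?t \<in> P" using iu(1) subset_chart by (auto simp: l_def intro: Pid(5))
    moreover have "l \<in> poly_over S" unfolding l_def using iu h' by (intro poly_over_closed)
    ultimately have "l \<in> K" by (simp add: K_def)
    then show ?thesis using h' iu by (intro bexI[of _ l]) (auto simp: l_def)
  qed
  \<comment> \<open>The residue of \<open>y / x\<close> is algebraic over the residue field of
    \<open>S\<close>: if it is not zero, its inverse is the value of a polynomial \<open>v\<close>,
    and \<open>X * v - 1\<close> has constant coefficient \<open>-1\<close>.\<close>
  have "\<exists>h\<in>K. h \<notin> poly_over (nonunits S)"
  proof (cases "?t \<in> P")
    case True
    have "[:0, 1:] \<in> K" using True by (auto simp: K_def intro: poly_over_closed)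
    moreover have "[:0, 1:] \<notin> poly_over (nonunits S)"
    proof
      assume "[:0, 1:] \<in> poly_over (nonunits S)"
      then have "coeff [:0, 1:] 1 \<in> nonunits S" by (rule poly_overD)
      then show False by simp
    qed
    ultimately show ?thesis by blast
  next
    case False
    then obtain b where b: "b \<in> chart" "?t * b - 1 \<in> P"
      using P ratio_chart unfolding B.maximalideal_iff by blast
    then obtain v where v: "v \<in> poly_over S" "b = poly v ?t" by (auto simp: chart_def)
    have "[:0, 1:] * v - 1 \<in> K" using b v by (auto simp: K_def intro!: poly_over_closed simp del: mult_pCons_left)
    moreover have "[:0, 1:] * v - 1 \<notin> poly_over (nonunits S)"
    proof
      assume "[:0, 1:] * v - 1 \<in> poly_over (nonunits S)"
      then have "coeff ([:0, 1:] * v - 1) 0 \<in> nonunits S" by (rule poly_overD)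
      then have "- 1 \<in> nonunits S" by simp
      then have "1 \<in> nonunits S" using nonunits_idealD(7)[of "- 1"] by simp
      then show False by simp
    qed
    ultimately show ?thesis by blast
  qed
  then have "\<exists>l. l \<in> K \<and> lead_coeff l = 1" using monic_K by blast
  define p where "p = arg_min degree (\<lambda>l. l \<in> K \<and> lead_coeff l = 1)"
  have p: "p \<in> K" "lead_coeff p = 1"
    using arg_min_natI[of "\<lambda>l. l \<in> K \<and> lead_coeff l = 1" _ degree] \<open>\<exists>l. l \<in> K \<and> lead_coeff l = 1\<close>
    unfolding p_def by blast+
  have p_min: "degree p \<le> degree l" if "l \<in> K" "lead_coeff l = 1" for l
    unfolding p_def by (rule arg_min_nat_le) (use that in blast)
  have pS: "p \<in> poly_over S" and pP: "poly p ?t \<in> P" using p by (auto simp: K_def)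
  have kernel: "\<exists>q\<in>poly_over S. \<exists>r\<in>poly_over (nonunits S). h = p * q + r" if h: "h \<in> K" for h
  proof -
    have hS: "h \<in> poly_over S" using h by (simp add: K_def)
    obtain q r where qr: "q \<in> poly_over S" "r \<in> poly_over S" "h = p * q + r" "\<forall>i\<ge>degree p. coeff r i = 0"
      using monic_division[OF ideal_self pS p(2) hS] by blast
    have "poly h ?t - poly p ?t * poly q ?t \<in> P"
      using h pP chartI[OF qr(1)] by (auto simp: K_def intro: Pid(6,8))
    then have rK: "r \<in> K" using qr by (simp add: K_def)
    have "r \<in> poly_over (nonunits S)"
    proof (rule ccontr)
      assume nr: "r \<notin> poly_over (nonunits S)"
      then have "r \<noteq> 0" using poly_over_ideal(2)[OF ideal_nonunits] by blast
      then have "degree r < degree p" using qr(4) by (metis leading_coeff_0_iff not_le)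
      moreover obtain l where "l \<in> K" "lead_coeff l = 1" "degree l \<le> degree r" using monic_K[OF rK nr] by blast
      ultimately show False using p_min[of l] by simp
    qed
    then show ?thesis using qr by blast
  qed
  have p_not_m: "p \<notin> poly_over (nonunits S)"
    using poly_overD[of p "nonunits S" "degree p"] p(2) by auto
  have pt_nz: "poly p ?t \<noteq> 0"
    using poly_ratio_zero_imp_nonunit_coeffs[OF pS] p_not_m by blast
  have chart_frac: "z \<in> ?T \<Longrightarrow> \<exists>h\<in>poly_over S. \<exists>k\<in>poly_over S. poly k ?t \<in> chart - P \<and> z = poly h ?t / poly k ?t" for z
    unfolding localization_at_def chart_def by blast
  have Pmem: "z \<in> P \<Longrightarrow> \<exists>h\<in>K. z = poly h ?t" for z
    using Pid(3)[of z] by (auto simp: chart_def K_def)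
  have "regular_params ?T (poly p ?t) x"
  proof
    show "poly p ?t \<in> ?T" "x \<in> ?T" using pP Pid(3) BT ST by auto
    show "poly p ?t \<noteq> 0" "x \<noteq> 0" using pt_nz x_nz by auto
    show "nonunits ?T = {poly p ?t * u + x * v |u v. u \<in> ?T \<and> v \<in> ?T}" (is "_ = ?R")
    proof
      show "nonunits ?T \<subseteq> ?R"
      proof
        fix z assume "z \<in> nonunits ?T"
        then obtain c s where c: "z = c / s" "c \<in> P" "s \<in> chart - P"
          unfolding B.nonunits_localization[OF pr] by blast
        obtain h where h: "h \<in> K" "c = poly h ?t" using Pmem[OF c(2)] by blast
        obtain q r where qr: "q \<in> poly_over S" "r \<in> poly_over (nonunits S)" "h = p * q + r"
          using kernel[OF h(1)] by blast
        obtain b where b: "b \<in> chart" "poly r ?t = x * b" using mx[OF qr(2)] by blast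
        have "z = poly p ?t * (poly q ?t / s) + x * (b / s)"
          using c h qr b by (simp add: add_divide_distrib)
        moreover have "poly q ?t / s \<in> ?T" "b / s \<in> ?T"
          using chartI[OF qr(1)] b c by (auto intro: B.localizationI[OF pr])
        ultimately show "z \<in> ?R" by blast
      qed
      show "?R \<subseteq> nonunits ?T"
      proof clarify
        fix u v assume "u \<in> ?T" "v \<in> ?T"
        then obtain c s d r where *: "u = c / s" "v = d / r" "c \<in> chart" "d \<in> chart" "s \<in> chart - P" "r \<in> chart - P"
          unfolding localization_at_def by blast
        then have "s \<noteq> 0" "r \<noteq> 0" using Pid(2) by auto
        then have "poly p ?t * u + x * v = (poly p ?t * (c * r) + x * (d * s)) / (s * r)"
          unfolding *(1,2) by (simp add: divide_simps)
        moreover have "poly p ?t * (c * r) + x * (d * s) \<in> P"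
          using * pP xP by (intro Pid(4) Pid(6)) auto
        ultimately show "poly p ?t * u + x * v \<in> nonunits ?T"
          using B.prime_compl_mult[OF pr *(5,6)] unfolding B.nonunits_localization[OF pr] by blast
      qed
    qed
    fix u v assume "u \<in> ?T" "v \<in> ?T" and eq: "poly p ?t * u = x * v"
    then obtain h k h' k' where *: "h \<in> poly_over S" "k \<in> poly_over S" "h' \<in> poly_over S" "k' \<in> poly_over S"
        "poly k ?t \<in> chart - P" "poly k' ?t \<in> chart - P" "u = poly h ?t / poly k ?t" "v = poly h' ?t / poly k' ?t"
      using chart_frac by metis
    then have nz: "poly k ?t \<noteq> 0" "poly k' ?t \<noteq> 0" using Pid(2) by auto
    \<comment> \<open>Clearing denominators turns the relation into a polynomial vanishing at
      \<open>y / x\<close>, so its coefficients are nonunits. Nonunit coefficients define a prime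
      ideal that contains neither \<open>p\<close> nor \<open>k'\<close>; it therefore contains
      \<open>h\<close>, and \<open>poly h ?t\<close> is a multiple of \<open>x\<close>.\<close>
    define g where "g = p * h * k' - [:x:] * h' * k"
    have gS: "g \<in> poly_over S" unfolding g_def using * pS by (intro poly_over_closed) auto
    have "poly p ?t * poly h ?t * poly k' ?t = x * poly h' ?t * poly k ?t"
      using eq nz by (simp add: * field_simps)
    then have "poly g ?t = 0" by (simp add: g_def)
    then have "g \<in> poly_over (nonunits S)" by (rule poly_ratio_zero_imp_nonunit_coeffs[OF gS])
    moreover have "[:x:] \<in> poly_over (nonunits S)"
      by (auto simp: poly_over_def coeff_pCons split: nat.split)
    then have "[:x:] * h' * k \<in> poly_over (nonunits S)"
      using * by (intro poly_over_ideal(7)[OF ideal_nonunits])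
    ultimately have "g + [:x:] * h' * k \<in> poly_over (nonunits S)" by (rule poly_over_ideal(3)[OF ideal_nonunits])
    then have "p * h * k' \<in> poly_over (nonunits S)" by (simp add: g_def)
    moreover have "k' \<notin> poly_over (nonunits S)" using mP[of k'] * by blast
    ultimately have "h \<in> poly_over (nonunits S)"
      using poly_over_nonunits_prime[OF ideal_nonunits] p_not_m pS * poly_over_closed(6) by blast
    then obtain b where "b \<in> chart" "poly h ?t = x * b" using mx by blast
    then have "u = x * (b / poly k ?t)" "b / poly k ?t \<in> ?T" using * by (auto intro: B.localizationI[OF pr])
    then show "\<exists>w\<in>?T. u = x * w" by blast
  qed
  then have Tp: "regular_params ?T x (poly p ?t)" by (rule regular_params.swap_params)
  have "quadratic_transform S x y ?T p"
  proof (intro quadratic_transform.intro quadratic_transform_axioms.intro)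
    show "\<exists>h\<in>poly_over S. \<exists>k\<in>poly_over S. poly k ?t \<notin> nonunits ?T \<and> z = poly h ?t / poly k ?t" if "z \<in> ?T" for z
      using chart_frac[OF that] nonunit_iff by blast
    show "\<exists>q\<in>poly_over S. \<exists>r\<in>poly_over (nonunits S). h = p * q + r"
      if "h \<in> poly_over S" "poly h ?t \<in> nonunits ?T" for h
      using kernel[of h] that nonunit_iff[OF chartI] by (auto simp: K_def)
    show "degree p \<le> degree l" if "l \<in> poly_over S" "lead_coeff l = 1" "poly l ?t \<in> nonunits ?T" for l
      using p_min[of l] that nonunit_iff[OF chartI] by (auto simp: K_def)
    show "\<exists>v\<in>poly_over S. poly h ?t * poly v ?t - 1 \<in> nonunits ?T"
      if h: "h \<in> poly_over S" "poly h ?t \<notin> nonunits ?T" for h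
    proof -
      have "poly h ?t \<in> chart - P" using h chartI nonunit_iff by blast
      then obtain b where b: "b \<in> chart" "poly h ?t * b - 1 \<in> P"
        using P unfolding B.maximalideal_iff by blast
      then obtain v where "v \<in> poly_over S" "b = poly v ?t" by (auto simp: chart_def)
      then show ?thesis using b nonunit_iff Pid(3) by blast
    qed
    show "y / x \<in> ?T" using BT ratio_chart by blast
  qed (use regular_params_axioms pS p(2) Tp ST in auto)
  then show ?thesis by blast
qed

text \<open>As \<open>a\<close> lies outside the square of the maximal ideal, one of its
  coefficients with respect to \<open>x\<close>, \<open>y\<close> is a unit. So \<open>a\<close> can
  replace one of the parameters, and the chart belongs to a pair starting with
  \<open>a\<close>.\<close>

lemma quadratic_transform_exists:
  assumes dim: "krull_dim (ring_on S) \<le> 2" and T: "local_quadratic_transform S T"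
  shows "krull_dim (ring_on T) \<le> 2 \<and> (\<exists>a b p. quadratic_transform S a b T p)"
proof -
  obtain a P where a: "a \<in> nonunits S - ideal_prod (ring_on S) (nonunits S) (nonunits S)"
    and P: "maximalideal P (ring_on (blowup_chart S a))" "height (ring_on (blowup_chart S a)) P = 2"
    and T_eq: "T = localization_at (blowup_chart S a) P"
    using T unfolding local_quadratic_transform_def max_ideal Let_def by blast
  obtain u v where uv: "a = x * u + y * v" "u \<in> S" "v \<in> S" using a unfolding nonunits_eq by blast
  have "\<exists>b. regular_params S a b"
  proof (cases "u \<in> nonunits S")
    case False
    then have "regular_params S (u * x + v * y) y" using change_first_param uv by blast
    then show ?thesis using uv by (auto simp: mult.commute)
  next
    case True
    have "v \<notin> nonunits S"
    proof
      assume v: "v \<in> nonunits S"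
      have "x \<otimes>\<^bsub>ring_on S\<^esub> u \<oplus>\<^bsub>ring_on S\<^esub> y \<otimes>\<^bsub>ring_on S\<^esub> v \<in> ideal_prod (ring_on S) (nonunits S) (nonunits S)"
        by (intro ideal_prod.sum ideal_prod.prod x_nonunit y_nonunit True v)
      then show False using a uv by simp
    qed
    interpret sw: regular_params S y x by (rule swap_params)
    have "regular_params S (v * y + u * x) x" using sw.change_first_param uv \<open>v \<notin> nonunits S\<close> by blast
    then show ?thesis using uv by (auto simp: mult.commute add.commute)
  qed
  then obtain b where "regular_params S a b" by blast
  then interpret ab: regular_params S a b .
  note P' = P[unfolded ab.blowup_chart_eq]
  interpret B: field_subring ab.chart by (rule ab.field_subring_chart)
  have pr: "primeideal P (ring_on ab.chart)" by (rule B.maximalideal_imp_primeideal[OF P'(1)])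
  have "a \<in> P" by (rule ab.x_in_height_2_prime[OF pr P'(2) dim])
  then have "\<exists>p. quadratic_transform S a b T p"
    unfolding T_eq ab.blowup_chart_eq by (rule ab.chart_localization[OF P'(1)])
  moreover have "krull_dim (ring_on T) \<le> 2"
    unfolding T_eq ab.blowup_chart_eq by (rule B.krull_dim_localization_le_2[OF pr P'(2)])
  ultimately show ?thesis by blast
qed

end


section \<open>Weierstrass preparation in a transform\<close>

text \<open>Membership in a power of the maximal ideal of a local ring, with the whole ring as power
  0. The inductive form gives direct inductions over products and sums of generators.\<close>

inductive nonunit_power :: "'a::field set \<Rightarrow> nat \<Rightarrow> 'a \<Rightarrow> bool" for S where
  zero: "z \<in> S \<Longrightarrow> nonunit_power S 0 z"
| mult: "i \<in> nonunits S \<Longrightarrow> nonunit_power S n z \<Longrightarrow> nonunit_power S (Suc n) (i * z)"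
| add: "nonunit_power S n z \<Longrightarrow> nonunit_power S n w \<Longrightarrow> nonunit_power S n (z + w)"

definition mpow :: "'a::field set \<Rightarrow> nat \<Rightarrow> 'a set" where
  "mpow S n = {z. nonunit_power S n z}"

lemma mpow_zeroI: "z \<in> S \<Longrightarrow> z \<in> mpow S 0"
  and mpow_multI: "i \<in> nonunits S \<Longrightarrow> z \<in> mpow S n \<Longrightarrow> i * z \<in> mpow S (Suc n)"
  and mpow_addI: "z \<in> mpow S n \<Longrightarrow> w \<in> mpow S n \<Longrightarrow> z + w \<in> mpow S n"
  by (auto simp: mpow_def intro: nonunit_power.intros)

lemma mpow_induct [consumes 1, case_names zero mult add]:
  assumes "z \<in> mpow S n"
    and "\<And>z. z \<in> S \<Longrightarrow> Q 0 z"
    and "\<And>i n z. i \<in> nonunits S \<Longrightarrow> z \<in> mpow S n \<Longrightarrow> Q n z \<Longrightarrow> Q (Suc n) (i * z)"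
    and "\<And>n z w. z \<in> mpow S n \<Longrightarrow> w \<in> mpow S n \<Longrightarrow> Q n z \<Longrightarrow> Q n w \<Longrightarrow> Q n (z + w)"
  shows "Q n z"
proof -
  have "nonunit_power S n z" using assms(1) by (simp add: mpow_def)
  then show ?thesis by induction (use assms in \<open>auto simp: mpow_def\<close>)
qed

lemma mpow_Suc_induct [consumes 1, case_names mult add]:
  assumes "z \<in> mpow S (Suc n)"
    and "\<And>i z. i \<in> nonunits S \<Longrightarrow> z \<in> mpow S n \<Longrightarrow> Q (i * z)"
    and "\<And>z w. z \<in> mpow S (Suc n) \<Longrightarrow> w \<in> mpow S (Suc n) \<Longrightarrow> Q z \<Longrightarrow> Q w \<Longrightarrow> Q (z + w)"
  shows "Q z"
proof -
  have "k = Suc n \<longrightarrow> Q z" if "z \<in> mpow S k" for k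
    using that by (induction rule: mpow_induct) (use assms in auto)
  then show ?thesis using assms(1) by blast
qed

lemma mpow_mono:
  assumes "S \<subseteq> T" "nonunits S \<subseteq> nonunits T" shows "mpow S n \<subseteq> mpow T n"
proof
  fix z assume "z \<in> mpow S n"
  then show "z \<in> mpow T n"
    by (induction rule: mpow_induct) (use assms in \<open>auto intro: mpow_zeroI mpow_multI mpow_addI\<close>)
qed

context field_subring begin

lemma mpow_ideal: "ideal (mpow S n) (ring_on S)"
  unfolding ideal_iff
proof (intro conjI ballI)
  have "z \<in> S" if "z \<in> mpow S n" for z n
    using that by (induction rule: mpow_induct) (use nonunits_subset in auto)
  then show "mpow S n \<subseteq> S" by blast
  show "0 \<in> mpow S n"
  proof (induction n)
    case (Suc n)
    then show ?case using mpow_multI[OF zero_nonunits Suc] by simp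
  qed (auto intro: mpow_zeroI)
  show "s * z \<in> mpow S n" if "z \<in> mpow S n" "s \<in> S" for s z
    using that
  proof (induction rule: mpow_induct)
    case (mult i n z)
    then show ?case using mpow_multI[of i S "s * z" n] by (simp add: mult.left_commute)
  qed (auto intro: mpow_zeroI mpow_addI simp: distrib_left)
qed (rule mpow_addI)

lemma mpow_zero [simp]: "mpow S 0 = S"
  using idealD(1)[OF mpow_ideal[of 0]] mpow_zeroI by blast

lemma mpow_Suc_subset: "mpow S (Suc n) \<subseteq> mpow S n"
proof
  fix z assume "z \<in> mpow S (Suc n)"
  then show "z \<in> mpow S n"
    by (induction rule: mpow_Suc_induct)
      (use nonunits_subset in \<open>auto intro: idealD(4,5)[OF mpow_ideal]\<close>)
qed

lemma mpow_antimono: "m \<le> n \<Longrightarrow> mpow S n \<subseteq> mpow S m"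
  by (rule lift_Suc_antimono_le[of "mpow S"]) (rule mpow_Suc_subset)

lemma nonunits_subset_mpow: "nonunits S \<subseteq> mpow S 1"
proof
  fix i assume "i \<in> nonunits S"
  from mpow_multI[OF this, of 1 0] show "i \<in> mpow S 1" by simp
qed

lemma mpow_mult: "z \<in> mpow S m \<Longrightarrow> w \<in> mpow S n \<Longrightarrow> z * w \<in> mpow S (m + n)"
proof (induction rule: mpow_induct)
  case (mult i m z)
  then show ?case using mpow_multI[of i S "z * w" "m + n"] by (simp add: mult.assoc)
qed (auto intro: idealD(5)[OF mpow_ideal] mpow_addI simp: distrib_right)

lemma nonunit_power_in_mpow: "z \<in> nonunits S \<Longrightarrow> z ^ n \<in> mpow S n"
  by (induction n) (auto intro: mpow_zeroI mpow_multI)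

lemma mpow_Suc_subset_nonunits:
  assumes m: "ideal (nonunits S) (ring_on S)" shows "mpow S (Suc n) \<subseteq> nonunits S"
proof
  fix z assume "z \<in> mpow S (Suc n)"
  then show "z \<in> nonunits S"
  proof (induction rule: mpow_Suc_induct)
    case (mult i z)
    then show ?case using idealD(3)[OF mpow_ideal mult(2)] by (auto intro: idealD(6)[OF m])
  qed (auto intro: idealD(4)[OF m])
qed

text \<open>The \<open>k\<close> extra factors from \<open>S\<close> are nonunits of
  \<open>T\<close> and survive the division by \<open>e\<close>. This turns a uniform divisibility
  into smallness of the quotient, and shows that the error of a Weierstrass preparation is
  harmless.\<close>

lemma mpow_divides_shift:
  assumes T: "field_subring T" "nonunits S \<subseteq> nonunits T"
    and div: "\<And>z. z \<in> mpow S N \<Longrightarrow> \<exists>w\<in>T. z = e * w"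
  shows "z \<in> mpow S (N + k) \<Longrightarrow> \<exists>w\<in>mpow T k. z = e * w"
proof (induction k arbitrary: z)
  case 0
  then show ?case using div field_subring.mpow_zero[OF T(1)] by auto
next
  case (Suc k)
  from Suc.prems have "z \<in> mpow S (Suc (N + k))" by simp
  then show ?case
  proof (induction rule: mpow_Suc_induct)
    case (mult i z)
    then obtain w where "w \<in> mpow T k" "z = e * w" using Suc.IH by blast
    then have "i * z = e * (i * w)" "i * w \<in> mpow T (Suc k)"
      using mult(1) T(2) by (auto intro: mpow_multI)
    then show ?case by blast
  next
    case (add z w)
    then obtain z' w' where "z' \<in> mpow T (Suc k)" "w' \<in> mpow T (Suc k)" "z = e * z'" "w = e * w'" by blast
    then have "z + w = e * (z' + w')" "z' + w' \<in> mpow T (Suc k)"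
      by (auto intro: mpow_addI simp: distrib_left)
    then show ?case by blast
  qed
qed

lemma unit_powerD: "u \<in> S \<Longrightarrow> u ^ n \<in> nonunits S \<Longrightarrow> u \<in> nonunits S"
  using unit_power[of u n] by blast

end

section \<open>Approximate Weierstrass form at a point of the exceptional line\<close>

context quadratic_transform begin

sublocale T: regular_params T x "poly p (y / x)"
  by (rule T_params)

lemma poly_over_subset: "poly_over S \<subseteq> poly_over T"
  by (rule poly_over_mono[OF S_subset])

lemma poly_eval_T: "h \<in> poly_over S \<Longrightarrow> poly h (y / x) \<in> T"
  using T.poly_eval_in[OF _ ratio_in] poly_over_subset by blast

lemma nonunits_factor_T:
  assumes "s \<in> nonunits S" shows "\<exists>u\<in>T. s = x * u"
proof -
  obtain u v where uv: "s = x * u + y * v" "u \<in> S" "v \<in> S" using assms unfolding nonunits_eq by blast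
  then have "s = x * (u + (y / x) * v)" using x_nz by (simp add: field_simps)
  moreover have "u + (y / x) * v \<in> T" using uv S_subset ratio_in by blast
  ultimately show ?thesis by blast
qed

lemma nonunits_subset_T: "nonunits S \<subseteq> nonunits T"
  using nonunits_factor_T T.nonunits_idealD(6)[OF T.x_nonunit] by fastforce

lemma nonunits_T_iff: "s \<in> S \<Longrightarrow> s \<in> nonunits T \<longleftrightarrow> s \<in> nonunits S"
  using nonunits_subset_T S_subset by (auto simp: nonunits_def)

lemma mpow_subset_T: "mpow S n \<subseteq> mpow T n"
  by (rule mpow_mono[OF S_subset nonunits_subset_T])

text \<open>Every nonunit of \<open>S\<close> is a multiple of \<open>x\<close> in \<open>T\<close>:
  \<open>d\<close> of the factors give up an \<open>x\<close>, and the remaining ones stay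
  nonunits.\<close>

lemma mpow_factor: "z \<in> mpow S k \<Longrightarrow> d \<le> k \<Longrightarrow> \<exists>w\<in>mpow T (k - d). z = x ^ d * w"
proof (induction arbitrary: d rule: mpow_induct)
  case (zero z)
  then show ?case using S_subset by (auto intro: mpow_zeroI)
next
  case (mult i n z)
  show ?case
  proof (cases d)
    case 0
    then show ?thesis using mpow_multI[OF mult(1,2)] mpow_subset_T by auto
  next
    case (Suc e)
    then obtain w where w: "w \<in> mpow T (n - e)" "z = x ^ e * w" using mult.IH[of e] mult.prems by auto
    obtain u where u: "u \<in> T" "i = x * u" using nonunits_factor_T mult(1) by blast
    have "i * z = x ^ d * (u * w)" using w u Suc by simp
    moreover have "u * w \<in> mpow T (Suc n - d)" using w u Suc by (auto intro: T.idealD(5)[OF T.mpow_ideal])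
    ultimately show ?thesis by blast
  qed
next
  case (add n z w)
  then obtain z' w' where "z' \<in> mpow T (n - d)" "w' \<in> mpow T (n - d)" "z = x ^ d * z'" "w = x ^ d * w'"
    by blast
  then have "z + w = x ^ d * (z' + w')" "z' + w' \<in> mpow T (n - d)"
    by (auto intro: mpow_addI simp: distrib_left)
  then show ?case by blast
qed

lemmas poly_over_S = poly_over_closed(1-6) poly_over_power p_in
lemmas poly_over_m = poly_over_ideal[OF ideal_nonunits]

lemma poly_eval_m: "h \<in> poly_over (nonunits S) \<Longrightarrow> poly h (y / x) \<in> nonunits T"
  using T.poly_eval_ideal[OF T.ideal_nonunits _ ratio_in] poly_over_mono[OF nonunits_subset_T] by blast

text \<open>A Newton step. If \<open>v * h\<close> is \<open>1 + p ^ Suc n * w\<close> up to nonunit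
  coefficients, multiplying by \<open>1 - p ^ Suc n * w\<close> leaves the error
  \<open>- (p ^ Suc n * w) ^ 2\<close>, of which one more factor \<open>p\<close> is
  recorded.\<close>

lemma unit_inverse_mod_p_power:
  assumes h: "h \<in> poly_over S" "poly h (y / x) \<notin> nonunits T"
  shows "\<exists>v\<in>poly_over S. \<exists>w\<in>poly_over S. poly v (y / x) \<notin> nonunits T \<and>
    v * h - 1 - p ^ Suc n * w \<in> poly_over (nonunits S)"
proof (induction n)
  case 0
  obtain v where v: "v \<in> poly_over S" "poly h (y / x) * poly v (y / x) - 1 \<in> nonunits T"
    using invert[OF h] by blast
  have "v * h - 1 \<in> poly_over S" using v h by (intro poly_over_S)
  moreover have "poly (v * h - 1) (y / x) \<in> nonunits T" using v by (simp add: mult.commute)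
  ultimately obtain q r where "q \<in> poly_over S" "r \<in> poly_over (nonunits S)" "v * h - 1 = p * q + r"
    using kernel by blast
  moreover have "poly v (y / x) \<notin> nonunits T"
  proof
    assume "poly v (y / x) \<in> nonunits T"
    then have "poly h (y / x) * poly v (y / x) \<in> nonunits T"
      using poly_eval_T[OF h(1)] by (rule T.nonunits_idealD(5))
    then have "poly h (y / x) * poly v (y / x) - (poly h (y / x) * poly v (y / x) - 1) \<in> nonunits T"
      using v(2) by (rule T.nonunits_idealD(8))
    then show False by simp
  qed
  ultimately show ?case using v(1) by force
next
  case (Suc n)
  then obtain v w where vw: "v \<in> poly_over S" "w \<in> poly_over S" "poly v (y / x) \<notin> nonunits T"
    "v * h - 1 - p ^ Suc n * w \<in> poly_over (nonunits S)" by blast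
  define c where "c = 1 - p ^ Suc n * w"
  have cS: "c \<in> poly_over S" unfolding c_def using vw by (intro poly_over_S)
  have "(v * h - 1 - p ^ Suc n * w) * c \<in> poly_over (nonunits S)" by (rule poly_over_m(7)[OF vw(4) cS])
  moreover have "(v * h - 1 - p ^ Suc n * w) * c = (v * c) * h - 1 - p ^ Suc (Suc n) * (- (p ^ n * w * w))"
    by (simp add: c_def algebra_simps)
  ultimately have "(v * c) * h - 1 - p ^ Suc (Suc n) * (- (p ^ n * w * w)) \<in> poly_over (nonunits S)" by simp
  moreover have "v * c \<in> poly_over S" "- (p ^ n * w * w) \<in> poly_over S"
    using vw cS by (auto intro!: poly_over_S)
  moreover have "poly (v * c) (y / x) \<notin> nonunits T"
  proof -
    have "poly (p ^ n * w) (y / x) * poly p (y / x) \<in> nonunits T"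
      by (rule T.nonunits_idealD(5)[OF T.y_nonunit poly_eval_T]) (use vw in \<open>auto intro!: poly_over_S\<close>)
    then have "- (poly (p ^ n * w) (y / x) * poly p (y / x)) \<in> nonunits T" by (rule T.nonunits_idealD(7))
    then have "1 + - (poly (p ^ n * w) (y / x) * poly p (y / x)) \<in> T - nonunits T"
      by (intro T.unit_add_nonunit[OF T.ideal_nonunits]) auto
    then have "poly c (y / x) \<in> T - nonunits T" by (simp add: c_def mult_ac)
    then show ?thesis using T.unit_mult[of "poly v (y / x)" "poly c (y / x)"] vw poly_eval_T[OF vw(1)] by simp
  qed
  ultimately show ?case by blast
qed

text \<open>Factors \<open>p\<close> are split off by \<open>kernel\<close> as long as the value at
  \<open>y / x\<close> is a nonunit. Once it is a unit, the cofactor is inverted modulo a power of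
  \<open>p\<close>; after \<open>n\<close> factors the process stops, and \<open>p ^ n * w\<close>
  takes up the rest.\<close>

lemma p_adic_normal_form:
  "h \<in> poly_over S \<Longrightarrow> \<exists>j. \<exists>v\<in>poly_over S. \<exists>w\<in>poly_over S. poly v (y / x) \<notin> nonunits T \<and>
    v * h - p ^ j - p ^ n * w \<in> poly_over (nonunits S)"
proof (induction n arbitrary: h)
  case 0
  have "h - 1 \<in> poly_over S" using 0 by (intro poly_over_S)
  moreover have "1 * h - p ^ 0 - p ^ 0 * (h - 1) \<in> poly_over (nonunits S)" using poly_over_m(2) by simp
  moreover have "poly 1 (y / x) \<notin> nonunits T" by simp
  ultimately show ?case using poly_over_S(2) by blast
next
  case (Suc n)
  show ?case
  proof (cases "poly h (y / x) \<in> nonunits T")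
    case False
    from unit_inverse_mod_p_power[OF Suc.prems False, of n] show ?thesis
      by (intro exI[of _ 0]) simp
  next
    case True
    obtain q r where qr: "q \<in> poly_over S" "r \<in> poly_over (nonunits S)" "h = p * q + r"
      using kernel[OF Suc.prems True] by blast
    obtain j v w where *: "v \<in> poly_over S" "w \<in> poly_over S" "poly v (y / x) \<notin> nonunits T"
      "v * q - p ^ j - p ^ n * w \<in> poly_over (nonunits S)" using Suc.IH[OF qr(1)] by blast
    have "p * (v * q - p ^ j - p ^ n * w) + v * r \<in> poly_over (nonunits S)"
      using poly_over_m(6)[OF p_in *(4)] poly_over_m(6)[OF *(1) qr(2)] by (rule poly_over_m(3))
    moreover have "p * (v * q - p ^ j - p ^ n * w) + v * r = v * h - p ^ Suc j - p ^ Suc n * w"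
      using qr(3) by (simp add: algebra_simps)
    ultimately have "v * h - p ^ Suc j - p ^ Suc n * w \<in> poly_over (nonunits S)" by simp
    then show ?thesis using * by blast
  qed
qed

lemma monic_power: "lead_coeff (p ^ j) = 1"
  by (simp add: lead_coeff_power monic)

text \<open>Stage \<open>n\<close> of the induction gets rid of the coefficients beyond the degree of \<open>p ^ j\<close> modulo
  \<open>mpow S (Suc n)\<close>; the term \<open>p ^ M * w\<close> is absorbed in \<open>mpow T M\<close>.\<close>

lemma weierstrass_polynomial:
  assumes h: "h \<in> poly_over S"
  shows "\<exists>j. \<exists>u\<in>T - nonunits T. \<exists>r\<in>poly_over (nonunits S). (\<forall>i\<ge>degree (p ^ j). coeff r i = 0) \<and>
    u * poly h (y / x) - poly (p ^ j + r) (y / x) \<in> mpow T M"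
proof -
  obtain j v w where *: "v \<in> poly_over S" "w \<in> poly_over S" "poly v (y / x) \<notin> nonunits T"
      "v * h - p ^ j - p ^ M * w \<in> poly_over (nonunits S)"
    using p_adic_normal_form[OF h] by blast
  have pj: "p ^ j \<in> poly_over S" by (rule poly_over_power[OF p_in])
  have stage: "\<exists>u\<in>T - nonunits T. \<exists>r\<in>poly_over (nonunits S). \<exists>e\<in>poly_over (mpow S (Suc n)). \<exists>d\<in>mpow T M.
      (\<forall>i\<ge>degree (p ^ j). coeff r i = 0) \<and> u * poly h (y / x) = poly (p ^ j + r + e) (y / x) + d" for n
  proof (induction n)
    case 0
    define e where "e = v * h - p ^ j - p ^ M * w"
    have "e \<in> poly_over (mpow S (Suc 0))" using *(4) poly_over_mono[OF nonunits_subset_mpow] unfolding e_def One_nat_def by blast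
    moreover have "poly p (y / x) ^ M * poly w (y / x) \<in> mpow T M"
      by (rule T.idealD(6)[OF T.mpow_ideal T.nonunit_power_in_mpow[OF T.y_nonunit] poly_eval_T[OF *(2)]])
    moreover have "poly v (y / x) * poly h (y / x) =
        poly (p ^ j + 0 + e) (y / x) + poly p (y / x) ^ M * poly w (y / x)"
      by (simp add: e_def)
    moreover have "poly v (y / x) \<in> T - nonunits T" using * poly_eval_T by blast
    ultimately show ?case using poly_over_m(2) by (metis coeff_0)
  next
    case (Suc n)
    then obtain u r e d where **: "u \<in> T - nonunits T" "r \<in> poly_over (nonunits S)" "e \<in> poly_over (mpow S (Suc n))"
        "d \<in> mpow T M" "\<forall>i\<ge>degree (p ^ j). coeff r i = 0"
        "u * poly h (y / x) = poly (p ^ j + r + e) (y / x) + d" by blast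
    \<comment> \<open>Multiplication by the unit \<open>1 - q\<close> cancels
      \<open>p ^ j * q\<close>, the part of \<open>e\<close> of too high degree, and leaves
      \<open>e'\<close> together with \<open>- q * (r + e)\<close>. The former joins
      \<open>r\<close>; the latter gains one order because \<open>r + e\<close> has nonunit
      coefficients.\<close>
    obtain q e' where qe: "q \<in> poly_over (mpow S (Suc n))" "e' \<in> poly_over (mpow S (Suc n))"
        "e = p ^ j * q + e'" "\<forall>i\<ge>degree (p ^ j). coeff e' i = 0"
      using monic_division[OF mpow_ideal pj monic_power **(3)] by blast
    have sub: "poly_over (mpow S (Suc n)) \<subseteq> poly_over (nonunits S)"
      by (rule poly_over_mono[OF mpow_Suc_subset_nonunits[OF ideal_nonunits]])
    have re: "r + e \<in> poly_over (mpow S 1)"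
      using poly_over_m(3)[of r e] ** sub poly_over_mono[OF nonunits_subset_mpow] by blast
    have "q * (r + e) \<in> poly_over (mpow S (Suc n + 1))"
      by (rule poly_over_mult[OF qe(1) re idealD(2)[OF mpow_ideal] mpow_addI mpow_mult])
    then have e2: "- (q * (r + e)) \<in> poly_over (mpow S (Suc (Suc n)))"
      using poly_over_ideal(5)[OF mpow_ideal] by simp
    have qm: "poly q (y / x) \<in> nonunits T" using poly_eval_m qe(1) sub by blast
    then have "1 + - poly q (y / x) \<in> T - nonunits T"
      by (intro T.unit_add_nonunit[OF T.ideal_nonunits]) (auto intro: T.nonunits_idealD(7))
    then have u1: "1 - poly q (y / x) \<in> T - nonunits T" by simp
    have "(u * (1 - poly q (y / x))) * poly h (y / x) = (1 - poly q (y / x)) * (u * poly h (y / x))"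
      by (simp add: mult_ac)
    also have "\<dots> = poly (p ^ j + (r + e') + (- (q * (r + e)))) (y / x) + (1 - poly q (y / x)) * d"
      unfolding **(6) using arg_cong[OF qe(3), of "\<lambda>e. poly e (y / x)"] by (simp add: algebra_simps)
    finally have "(u * (1 - poly q (y / x))) * poly h (y / x) =
        poly (p ^ j + (r + e') + (- (q * (r + e)))) (y / x) + (1 - poly q (y / x)) * d" .
    moreover have "(1 - poly q (y / x)) * d \<in> mpow T M" using u1 by (intro T.idealD(5)[OF T.mpow_ideal **(4)]) auto
    moreover have "r + e' \<in> poly_over (nonunits S)" using ** qe sub by (intro poly_over_m(3)) auto
    moreover have "u * (1 - poly q (y / x)) \<in> T - nonunits T" by (rule T.unit_mult[OF **(1) u1])
    moreover have "\<forall>i\<ge>degree (p ^ j). coeff (r + e') i = 0" using ** qe by simp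
    ultimately show ?case using e2 by blast
  qed
  obtain u r e d where **: "u \<in> T - nonunits T" "r \<in> poly_over (nonunits S)" "e \<in> poly_over (mpow S (Suc M))"
      "d \<in> mpow T M" "\<forall>i\<ge>degree (p ^ j). coeff r i = 0"
      "u * poly h (y / x) = poly (p ^ j + r + e) (y / x) + d" using stage[of M] by blast
  have "e \<in> poly_over (mpow T M)"
    using **(3) poly_over_mono[OF order_trans[OF mpow_Suc_subset mpow_subset_T]] by blast
  then have "poly e (y / x) + d \<in> mpow T M"
    using T.poly_eval_ideal[OF T.mpow_ideal _ ratio_in] **(4) by (blast intro: mpow_addI)
  then have "u * poly h (y / x) - poly (p ^ j + r) (y / x) \<in> mpow T M" using **(6) by simp
  then show ?thesis using ** by blast
qed

lemma weierstrass:
  assumes f: "f \<in> T"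
  shows "\<exists>j. \<exists>u\<in>T - nonunits T. \<exists>r\<in>poly_over (nonunits S). (\<forall>i\<ge>degree (p ^ j). coeff r i = 0) \<and>
    u * f - poly (p ^ j + r) (y / x) \<in> mpow T M"
proof -
  obtain h k where hk: "h \<in> poly_over S" "k \<in> poly_over S" "poly k (y / x) \<notin> nonunits T"
      "f = poly h (y / x) / poly k (y / x)" using fraction[OF f] by blast
  have k: "poly k (y / x) \<in> T - nonunits T" using poly_eval_T hk by blast
  obtain j u r where *: "u \<in> T - nonunits T" "r \<in> poly_over (nonunits S)" "\<forall>i\<ge>degree (p ^ j). coeff r i = 0"
      "u * poly h (y / x) - poly (p ^ j + r) (y / x) \<in> mpow T M"
    using weierstrass_polynomial[OF hk(1)] by blast
  have "u * poly h (y / x) = (u * poly k (y / x)) * f" using hk T.unitD[OF k] by simp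
  then show ?thesis using * T.unit_mult[OF *(1) k] by metis
qed

text \<open>The unit \<open>x / a\<close> makes \<open>y / x\<close> a coordinate at
  \<open>T'\<close> too, so both rings come from the same point of the exceptional line, seen in two
  charts. By \<open>kernel\<close> and \<open>invert\<close>, evaluation at \<open>y / x\<close>
  sends nonunits of \<open>T\<close> to nonunits of \<open>T'\<close> and units to units, so
  \<open>T'\<close> dominates \<open>T\<close>.\<close>

lemma transform_eqI:
  assumes T': "quadratic_transform S a b T' p'"
    and ax: "x / a \<in> T' - nonunits T'" and t: "y / x \<in> T'" and pt: "poly p (y / x) \<in> nonunits T'"
  shows "T' = T"
proof -
  interpret Q: quadratic_transform S a b T' p' by (rule T')
  have evT': "poly h (y / x) \<in> T'" if "h \<in> poly_over S" for h
    using Q.T.poly_eval_in[OF _ t] Q.poly_over_subset that by blast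
  have mT': "poly h (y / x) \<in> nonunits T'" if "h \<in> poly_over (nonunits S)" for h
    using Q.T.poly_eval_ideal[OF Q.T.ideal_nonunits _ t] poly_over_mono[OF Q.nonunits_subset_T] that by blast
  have non: "poly h (y / x) \<in> nonunits T'" if h: "h \<in> poly_over S" "poly h (y / x) \<in> nonunits T" for h
  proof -
    obtain q r where "q \<in> poly_over S" "r \<in> poly_over (nonunits S)" "h = p * q + r"
      using kernel[OF h] by blast
    then show ?thesis
      using pt mT' evT' by (auto intro!: Q.T.nonunits_idealD(4) Q.T.nonunits_idealD(6))
  qed
  have unit: "poly h (y / x) \<in> T' - nonunits T'" if h: "h \<in> poly_over S" "poly h (y / x) \<notin> nonunits T" for h
  proof -
    obtain v where v: "v \<in> poly_over S" "poly h (y / x) * poly v (y / x) - 1 \<in> nonunits T"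
      using invert[OF h] by blast
    have "h * v - 1 \<in> poly_over S" using h v by (intro poly_over_S)
    then have "poly (h * v - 1) (y / x) \<in> nonunits T'" using non[of "h * v - 1"] v(2) by simp
    moreover have False if "poly h (y / x) \<in> nonunits T'"
    proof -
      have "poly h (y / x) * poly v (y / x) \<in> nonunits T'" using that evT'[OF v(1)] by (rule Q.T.nonunits_idealD(6))
      then have "poly h (y / x) * poly v (y / x) - poly (h * v - 1) (y / x) \<in> nonunits T'"
        using \<open>poly (h * v - 1) (y / x) \<in> nonunits T'\<close> by (rule Q.T.nonunits_idealD(8))
      then show False by simp
    qed
    ultimately show ?thesis using evT' h by blast
  qed
  have sub: "z \<in> T'" if z: "z \<in> T" for z
  proof -
    obtain h k where hk: "h \<in> poly_over S" "k \<in> poly_over S" "poly k (y / x) \<notin> nonunits T"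
      "z = poly h (y / x) / poly k (y / x)" using fraction[OF z] by blast
    then show ?thesis using Q.T.unitD[OF unit[OF hk(2,3)]] evT'[OF hk(1)] by (auto simp: divide_inverse)
  qed
  have unitT: "z \<notin> nonunits T" if z: "z \<in> T" "z \<notin> nonunits T'" for z
  proof
    assume "z \<in> nonunits T"
    obtain h k where hk: "h \<in> poly_over S" "k \<in> poly_over S" "poly k (y / x) \<notin> nonunits T"
      "z = poly h (y / x) / poly k (y / x)" using fraction[OF z(1)] by blast
    note k' = Q.T.unitD[OF unit[OF hk(2,3)]]
    have "poly h (y / x) = z * poly k (y / x)" using hk k' by simp
    then have "poly h (y / x) \<in> nonunits T"
      using T.nonunits_idealD(6)[OF \<open>z \<in> nonunits T\<close> poly_eval_T[OF hk(2)]] by simp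
    then have "poly h (y / x) * inverse (poly k (y / x)) \<in> nonunits T'"
      using non[OF hk(1)] k' by (intro Q.T.nonunits_idealD(6))
    then show False using z hk by (simp add: divide_inverse)
  qed
  have "T' \<subseteq> T"
  proof
    \<comment> \<open>The inverse of \<open>c\<close> is \<open>x / a\<close>, so \<open>c\<close>
      is a unit of \<open>T'\<close> and, by domination, of \<open>T\<close>. Hence the coordinate
      \<open>b / a\<close> of the other chart already lies in \<open>T\<close>.\<close>
    obtain c d where c: "c \<in> T" "a = x * c" and d: "d \<in> T" "b = x * d"
      using nonunits_factor_T[OF Q.x_nonunit] nonunits_factor_T[OF Q.y_nonunit] by blast
    have "inverse (x / a) = c" using c x_nz Q.x_nz by (auto simp: field_simps)
    then have "c \<notin> nonunits T'" using Q.T.unit_inverse[OF ax] by simp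
    then have ic: "inverse c \<in> T" using unitT[OF c(1)] T.unitD[of c] c by blast
    have "b / a = d * inverse c" using c d x_nz by (simp add: divide_inverse)
    then have ba: "b / a \<in> T" using ic d by simp
    have ev: "poly h (b / a) \<in> T" if "h \<in> poly_over S" for h
      using T.poly_eval_in[OF _ ba] poly_over_subset that by blast
    fix z assume "z \<in> T'"
    then obtain h k where hk: "h \<in> poly_over S" "k \<in> poly_over S" "poly k (b / a) \<notin> nonunits T'"
      "z = poly h (b / a) / poly k (b / a)" using Q.fraction by blast
    have "inverse (poly k (b / a)) \<in> T"
      using unitT[OF ev[OF hk(2)] hk(3)] T.unitD[of "poly k (b / a)"] ev[OF hk(2)] by blast
    then show "z \<in> T" using ev[OF hk(1)] hk(4) by (simp add: divide_inverse)
  qed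
  then show ?thesis using sub by blast
qed

text \<open>With \<open>x = a * x'\<close> and \<open>y = a * y'\<close>, the element
  \<open>x ^ d * g (y / x)\<close> is \<open>a ^ d\<close> times the form \<open>F\<close> obtained
  by homogenizing \<open>g\<close> at \<open>x'\<close>, \<open>y'\<close>. Modulo nonunits
  \<open>F\<close> is the homogenized \<open>p ^ j\<close>, which vanishes only at \<open>T\<close>.
  So \<open>F\<close> is a unit of \<open>T'\<close>, and powers of order \<open>d\<close> are
  multiples of \<open>a ^ d\<close>.\<close>

lemma strict_transform_off_other_points:
  assumes T': "quadratic_transform S a b T' p'" "T' \<noteq> T"
    and r: "r \<in> poly_over (nonunits S)" "\<forall>i\<ge>degree (p ^ j). coeff r i = 0"
    and z: "z \<in> mpow S (degree (p ^ j))"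
  shows "\<exists>w\<in>T'. z = x ^ degree (p ^ j) * poly (p ^ j + r) (y / x) * w"
proof -
  interpret Q: quadratic_transform S a b T' p' by (rule T'(1))
  define d where "d = degree (p ^ j)"
  define g where "g = p ^ j + r"
  have rS: "r \<in> poly_over S" using r(1) poly_over_m(1) by blast
  have gS: "g \<in> poly_over S" unfolding g_def using rS by (intro poly_over_S)
  have g_high: "coeff g i = 0" if "i > d" for i using that r(2) by (simp add: g_def d_def coeff_eq_0)
  have g_lead: "coeff g d = 1" using r(2) monic_power[of j] by (simp add: g_def d_def)
  obtain x' y' where x': "x' \<in> T'" "x = a * x'" and y': "y' \<in> T'" "y = a * y'"
    using Q.nonunits_factor_T[OF x_nonunit] Q.nonunits_factor_T[OF y_nonunit] by blast
  have nz: "a \<noteq> 0" "x' \<noteq> 0" using Q.x_nz x' x_nz by auto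
  obtain s s' where ss: "a = x * s + y * s'" "s \<in> S" "s' \<in> S" using Q.x_nonunit unfolding nonunits_eq by blast
  have "a * (x' * s + y' * s') = a * 1" using ss x' y' by (simp add: algebra_simps)
  then have one: "x' * s + y' * s' = 1" using nz by simp
  have not_both: "\<not> (x' \<in> nonunits T' \<and> y' \<in> nonunits T')"
  proof
    assume "x' \<in> nonunits T' \<and> y' \<in> nonunits T'"
    then have "x' * s + y' * s' \<in> nonunits T'"
      using ss Q.S_subset by (intro Q.T.nonunits_idealD(4) Q.T.nonunits_idealD(6)) auto
    then show False using one by simp
  qed
  define F where "F = x' ^ d * poly g (y / x)"
  have "F = (\<Sum>i\<le>d. coeff g i * y' ^ i * x' ^ (d - i))"
  proof -
    have "a ^ d * F = x ^ d * poly g (y / x)" by (simp add: F_def x' power_mult_distrib)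
    also have "\<dots> = (\<Sum>i\<le>d. coeff g i * y ^ i * x ^ (d - i))" by (rule clear_denominators[OF gS g_high])
    also have "\<dots> = (\<Sum>i\<le>d. a ^ d * (coeff g i * y' ^ i * x' ^ (d - i)))"
    proof (rule sum.cong)
      fix i assume "i \<in> {..d}"
      then have "a ^ d = a ^ i * a ^ (d - i)" by (simp flip: power_add)
      then show "coeff g i * y ^ i * x ^ (d - i) = a ^ d * (coeff g i * y' ^ i * x' ^ (d - i))"
        by (simp add: x' y' power_mult_distrib mult_ac)
    qed simp
    also have "\<dots> = a ^ d * (\<Sum>i\<le>d. coeff g i * y' ^ i * x' ^ (d - i))" by (simp add: sum_distrib_left)
    finally show ?thesis using nz by simp
  qed
  also have "\<dots> = (\<Sum>i<d. coeff g i * y' ^ i * x' ^ (d - i)) + y' ^ d"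
    using g_lead by (simp add: lessThan_Suc_atMost[symmetric])
  finally have F: "F = (\<Sum>i<d. coeff g i * y' ^ i * x' ^ (d - i)) + y' ^ d" .
  have gT': "coeff g i \<in> T'" for i using poly_overD[OF gS] Q.S_subset by blast
  have "(\<Sum>i<d. coeff g i * y' ^ i * x' ^ (d - i)) \<in> T'"
    by (intro Q.T.sum_in Q.T.mult_in Q.T.power_in gT' x' y')
  then have FT': "F \<in> T'" unfolding F using y' by auto
  have "F \<notin> nonunits T'"
  proof
    assume Fm: "F \<in> nonunits T'"
    show False
    proof (cases "x' \<in> nonunits T'")
      case True
      \<comment> \<open>This is the point at infinity. All terms containing \<open>x'\<close> are
        nonunits, and since \<open>g\<close> is monic of degree \<open>d\<close> the remaining term
        is \<open>y' ^ d\<close>, with \<open>y'\<close> a unit.\<close>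
      have "coeff g i * y' ^ i * x' ^ (d - i) \<in> nonunits T'" if i: "i < d" for i
      proof -
        have "(coeff g i * y' ^ i * x' ^ (d - Suc i)) * x' \<in> nonunits T'"
          using gT' y' x' by (intro Q.T.nonunits_idealD(5)[OF True]) auto
        moreover have "d - i = Suc (d - Suc i)" using i by simp
        ultimately show ?thesis by (simp add: mult_ac)
      qed
      then have "(\<Sum>i\<in>I. coeff g i * y' ^ i * x' ^ (d - i)) \<in> nonunits T'" if "I \<subseteq> {..<d}" for I
        using that by (induction I rule: infinite_finite_induct) (auto intro: Q.T.nonunits_idealD(4))
      then have "F - (\<Sum>i<d. coeff g i * y' ^ i * x' ^ (d - i)) \<in> nonunits T'"
        using Fm by (intro Q.T.nonunits_idealD(8)) auto
      then have "y' ^ d \<in> nonunits T'" using F by simp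
      then show False using Q.T.unit_powerD y' True not_both by blast
    next
      case False
      \<comment> \<open>Inside the chart a nonunit \<open>F\<close> would make \<open>p\<close>
        vanish at \<open>T'\<close>, and \<open>T'\<close> would be \<open>T\<close>.\<close>
      then have xu: "x' \<in> T' - nonunits T'" using x' by blast
      have "y / x = y' * inverse x'" using x' y' nz by (simp add: field_simps)
      then have t: "y / x \<in> T'" using Q.T.unitD[OF xu] y' by simp
      have "inverse (x' ^ d) * F \<in> nonunits T'"
        using Q.T.unitD[OF Q.T.unit_power[OF xu]] by (intro Q.T.nonunits_idealD(5)[OF Fm]) auto
      then have "poly g (y / x) \<in> nonunits T'" using nz by (simp add: F_def mult.assoc[symmetric])
      moreover have "poly r (y / x) \<in> nonunits T'"
        using Q.T.poly_eval_ideal[OF Q.T.ideal_nonunits _ t] poly_over_mono[OF Q.nonunits_subset_T] r(1) by blast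
      ultimately have "poly g (y / x) - poly r (y / x) \<in> nonunits T'" by (rule Q.T.nonunits_idealD(8))
      then have "poly p (y / x) ^ j \<in> nonunits T'" by (simp add: g_def)
      moreover have "poly p (y / x) \<in> T'" using Q.T.poly_eval_in[OF _ t] Q.poly_over_subset p_in by blast
      ultimately have "poly p (y / x) \<in> nonunits T'" using Q.T.unit_powerD by blast
      moreover have "x / a \<in> T' - nonunits T'" using xu x' nz by simp
      ultimately have "T' = T" using transform_eqI[OF T'(1)] t by blast
      then show False using T'(2) by blast
    qed
  qed
  then have Fu: "F \<in> T' - nonunits T'" using FT' by blast
  have eq: "a ^ d * F = x ^ d * poly g (y / x)" by (simp add: F_def x' power_mult_distrib)
  obtain w where w: "w \<in> T'" "z = a ^ d * w"
    using Q.mpow_factor[of z d d] z Q.T.mpow_zero unfolding d_def by auto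
  have "z = (a ^ d * F) * (inverse F * w)" using w Q.T.unitD[OF Fu] by simp
  then have "z = x ^ d * poly g (y / x) * (inverse F * w)" using eq by simp
  moreover have "inverse F * w \<in> T'" using w Q.T.unitD[OF Fu] by auto
  ultimately show ?thesis unfolding d_def g_def by blast
qed

end


section \<open>The separating element\<close>

text \<open>The closure can be peeled at both ends: domination and monomials are followed upwards
  from the root, while the separating element is built by converse induction, from the given point
  downwards.\<close>

lemma quadratic_tree_iff: "T \<in> quadratic_tree S \<longleftrightarrow> local_quadratic_transform\<^sup>*\<^sup>* S T"
proof
  show "T \<in> quadratic_tree S \<Longrightarrow> local_quadratic_transform\<^sup>*\<^sup>* S T"
    by (induction rule: quadratic_tree.induct) auto
  show "local_quadratic_transform\<^sup>*\<^sup>* S T \<Longrightarrow> T \<in> quadratic_tree S"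
    by (induction rule: rtranclp_induct) (auto intro: quadratic_tree.intros)
qed

text \<open>The data that pass from a ring to its transforms: parameters forming a regular sequence,
  and the dimension bound that places height 2 maximal ideals of a chart on the exceptional
  line.\<close>

definition regular_surface_ring :: "'a::field set \<Rightarrow> bool" where
  "regular_surface_ring S \<longleftrightarrow> (\<exists>x y. regular_params S x y) \<and> krull_dim (ring_on S) \<le> 2"

lemma regular_surface_ring_transform:
  assumes "regular_surface_ring S" "local_quadratic_transform S T"
  shows "regular_surface_ring T" "\<exists>x y p. quadratic_transform S x y T p"
proof -
  obtain x y where "regular_params S x y" using assms(1) by (auto simp: regular_surface_ring_def)
  then interpret regular_params S x y .
  have *: "krull_dim (ring_on T) \<le> 2 \<and> (\<exists>a b p. quadratic_transform S a b T p)"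
    using quadratic_transform_exists assms by (simp add: regular_surface_ring_def)
  then show "\<exists>x y p. quadratic_transform S x y T p" by blast
  show "regular_surface_ring T"
    using * quadratic_transform.T_params unfolding regular_surface_ring_def by blast
qed

lemma tree_dominates:
  assumes "local_quadratic_transform\<^sup>*\<^sup>* S T" "regular_surface_ring S"
  shows "S \<subseteq> T \<and> nonunits S \<subseteq> nonunits T \<and> regular_surface_ring T"
  using assms(1)
proof (induction rule: rtranclp_induct)
  case (step T T')
  then obtain x y p where "quadratic_transform T x y T' p" using regular_surface_ring_transform(2) by blast
  then interpret quadratic_transform T x y T' p .
  show ?case using step S_subset nonunits_subset_T regular_surface_ring_transform(1) by blast
qed (use assms in auto)

context regular_params begin

text \<open>
  Lines transversal to both coordinate axes: coprime to every monomial in \<open>x\<close> and \<open>y\<close>, and stable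
  under the changes made by the Weierstrass preparation.
\<close>

definition diagonal_params :: "'a set" where
  "diagonal_params = {u * x + v * y | u v. u \<in> S - nonunits S \<and> v \<in> S - nonunits S}"

lemma diagonal_params_nonunit: "g \<in> diagonal_params \<Longrightarrow> g \<in> nonunits S"
  unfolding diagonal_params_def by (auto intro!: nonunits_idealD(4) nonunits_idealD(5))

lemma diagonal_params_nz:
  assumes "g \<in> diagonal_params" shows "g \<noteq> 0"
proof -
  obtain u v where uv: "g = u * x + v * y" "u \<in> S - nonunits S" "v \<in> S"
    using assms unfolding diagonal_params_def by blast
  then show ?thesis using regular_params.x_nz[OF change_first_param[OF uv(2,3)]] by simp
qed

lemma mpow_2_eq: "w \<in> mpow S 2 \<Longrightarrow> \<exists>r\<in>nonunits S. \<exists>s\<in>nonunits S. w = r * x + s * y"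
  unfolding numeral_2_eq_2
proof (induction rule: mpow_Suc_induct)
  case (mult i z)
  then obtain u v where uv: "i = x * u + y * v" "u \<in> S" "v \<in> S" unfolding nonunits_eq by blast
  have "z \<in> nonunits S" using mpow_Suc_subset_nonunits[OF ideal_nonunits] mult by blast
  then have "u * z \<in> nonunits S" "v * z \<in> nonunits S" using uv by (auto intro: nonunits_mult)
  moreover have "i * z = (u * z) * x + (v * z) * y" using uv by (simp add: algebra_simps)
  ultimately show ?case by blast
next
  case (add z w)
  then obtain r s r' s' where "r \<in> nonunits S" "s \<in> nonunits S" "r' \<in> nonunits S" "s' \<in> nonunits S"
    "z = r * x + s * y" "w = r' * x + s' * y" by blast
  then have "z + w = (r + r') * x + (s + s') * y" "r + r' \<in> nonunits S" "s + s' \<in> nonunits S"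
    by (auto simp: algebra_simps intro: nonunits_idealD(4))
  then show ?case by blast
qed

text \<open>An element of \<open>mpow S 2\<close> has nonunit coefficients with respect to
  \<open>x\<close> and \<open>y\<close>, so the unit coefficients of \<open>e * g\<close> remain
  units after adding it.\<close>

lemma diagonal_params_perturb:
  assumes "g \<in> diagonal_params" "e \<in> S - nonunits S" "w \<in> mpow S 2"
  shows "e * g + w \<in> diagonal_params"
proof -
  obtain u v where uv: "g = u * x + v * y" "u \<in> S - nonunits S" "v \<in> S - nonunits S"
    using assms(1) unfolding diagonal_params_def by blast
  obtain r s where rs: "r \<in> nonunits S" "s \<in> nonunits S" "w = r * x + s * y"
    using mpow_2_eq[OF assms(3)] by blast
  have "e * g + w = (e * u + r) * x + (e * v + s) * y" using uv rs by (simp add: algebra_simps)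
  moreover have "e * u + r \<in> S - nonunits S" "e * v + s \<in> S - nonunits S"
    using unit_add_nonunit[OF ideal_nonunits unit_mult] uv rs assms(2) by blast+
  ultimately show ?thesis unfolding diagonal_params_def by blast
qed

text \<open>From \<open>(u * x + v * y) * h = w * y ^ Suc l\<close> the regular sequence property
  gives a factor \<open>y\<close> of \<open>h\<close>, which can be cancelled. In the end the
  nonunit \<open>g\<close> would divide a unit.\<close>

lemma diagonal_params_not_dvd_y_power:
  assumes g: "g \<in> diagonal_params" and w: "w \<in> S - nonunits S"
  shows "h \<in> S \<Longrightarrow> g * h \<noteq> w * y ^ l"
proof (induction l arbitrary: h)
  case 0
  then show ?case using nonunits_idealD(6)[OF diagonal_params_nonunit[OF g]] w by auto
next
  case (Suc l)
  show ?case
  proof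
    assume eq: "g * h = w * y ^ Suc l"
    obtain u v where uv: "g = u * x + v * y" "u \<in> S - nonunits S" "v \<in> S - nonunits S"
      using g unfolding diagonal_params_def by blast
    have "x * (u * h) = y * (w * y ^ l - v * h)" using eq uv(1) by (simp add: algebra_simps)
    moreover have "u * h \<in> S" "w * y ^ l - v * h \<in> S" using Suc.prems uv w by auto
    ultimately obtain c where c: "c \<in> S" "u * h = y * c" using regular by blast
    have iu: "inverse u \<in> S" "u \<noteq> 0" using unitD[OF uv(2)] by auto
    then have "h = y * (inverse u * c)" using c by (simp add: field_simps)
    then have "y * (g * (inverse u * c)) = y * (w * y ^ l)" using eq by (simp add: mult_ac)
    then have "g * (inverse u * c) = w * y ^ l" using y_nz by simp
    then show False using Suc.IH[of "inverse u * c"] iu c by auto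
  qed
qed

lemma diagonal_params_not_dvd_monomial:
  assumes g: "g \<in> diagonal_params" and w: "w \<in> S - nonunits S"
  shows "h \<in> S \<Longrightarrow> g * h \<noteq> w * x ^ k * y ^ l"
proof (induction k arbitrary: h)
  case 0
  then show ?case using diagonal_params_not_dvd_y_power[OF g w] by simp
next
  case (Suc k)
  interpret sw: regular_params S y x by (rule swap_params)
  show ?case
  proof
    assume eq: "g * h = w * x ^ Suc k * y ^ l"
    obtain u v where uv: "g = u * x + v * y" "u \<in> S - nonunits S" "v \<in> S - nonunits S"
      using g unfolding diagonal_params_def by blast
    have "y * (v * h) = x * (w * x ^ k * y ^ l - u * h)" using eq uv(1) by (simp add: algebra_simps)
    moreover have "v * h \<in> S" "w * x ^ k * y ^ l - u * h \<in> S" using Suc.prems uv w by auto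
    ultimately obtain c where c: "c \<in> S" "v * h = x * c" using sw.regular by blast
    have iu: "inverse v \<in> S" "v \<noteq> 0" using unitD[OF uv(3)] by auto
    then have "h = x * (inverse v * c)" using c by (simp add: field_simps)
    then have "x * (g * (inverse v * c)) = x * (w * x ^ k * y ^ l)" using eq by (simp add: mult_ac)
    then have "g * (inverse v * c) = w * x ^ k * y ^ l" using x_nz by simp
    then show False using Suc.IH[of "inverse v * c"] iu c by auto
  qed
qed

text \<open>
  In \<open>f = e * g\<close>, the factor \<open>e\<close> collects the exceptional parameters and \<open>g\<close> is the strict transform of \<open>f\<close> at \<open>S\<close>.
\<close>

lemma separating_element:
  assumes "local_quadratic_transform\<^sup>*\<^sup>* R S" "regular_surface_ring R"
  shows "\<exists>f\<in>R. \<exists>N. \<exists>e\<in>S. \<exists>g\<in>diagonal_params. f = e * g \<and> (\<forall>z\<in>mpow R N. \<exists>w\<in>S. z = e * w) \<and>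
    (\<forall>\<beta>. local_quadratic_transform\<^sup>*\<^sup>* R \<beta> \<longrightarrow> \<not> S \<subseteq> \<beta> \<longrightarrow> \<not> \<beta> \<subseteq> S \<longrightarrow> (\<forall>z\<in>mpow R N. \<exists>w\<in>\<beta>. z = f * w))"
  using assms
proof (induction rule: converse_rtranclp_induct)
  case base
  have "1 \<in> S - nonunits S" by simp
  then have "1 * x + 1 * y \<in> diagonal_params" unfolding diagonal_params_def by blast
  then have "x + y \<in> diagonal_params" by simp
  \<comment> \<open>Every ring of the tree over \<open>S\<close> contains \<open>S\<close>, so no
    incomparable point exists yet and \<open>N = 0\<close>, \<open>e = 1\<close> suffice.\<close>
  moreover have "\<not> (local_quadratic_transform\<^sup>*\<^sup>* S \<beta> \<and> \<not> S \<subseteq> \<beta>)" for \<beta>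
    using tree_dominates base by blast
  ultimately show ?case
    by (intro bexI[of _ "x + y"] exI[of _ 0] bexI[of _ 1]) auto
next
  case (step R R1)
  note good1 = regular_surface_ring_transform(1)[OF step.prems step.hyps(1)]
  obtain a b p where "quadratic_transform R a b R1 p"
    using regular_surface_ring_transform(2)[OF step.prems step.hyps(1)] by blast
  then interpret Q: quadratic_transform R a b R1 p .
  obtain f1 N1 e1 g1 where IH: "f1 \<in> R1" "e1 \<in> S" "g1 \<in> diagonal_params" "f1 = e1 * g1"
    "\<forall>z\<in>mpow R1 N1. \<exists>w\<in>S. z = e1 * w"
    "\<forall>\<beta>. local_quadratic_transform\<^sup>*\<^sup>* R1 \<beta> \<longrightarrow> \<not> S \<subseteq> \<beta> \<longrightarrow> \<not> \<beta> \<subseteq> S \<longrightarrow>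
      (\<forall>z\<in>mpow R1 N1. \<exists>w\<in>\<beta>. z = f1 * w)"
    using step.IH[OF good1] by (elim bexE exE conjE) (rule that)
  have dom: "R1 \<subseteq> S" "nonunits R1 \<subseteq> nonunits S" using tree_dominates[OF step(2) good1] by auto
  \<comment> \<open>The accuracy \<open>N1 + 2\<close>: at \<open>S\<close> and at incomparable
    points over \<open>R1\<close>, \<open>N1\<close> factors pay for divisibility by
    \<open>e1\<close> or \<open>f1\<close>, and the quotient of the error still lies in the square
    of the maximal ideal.\<close>
  obtain j u r where W: "u \<in> R1 - nonunits R1" "r \<in> poly_over (nonunits R)" "\<forall>i\<ge>degree (p ^ j). coeff r i = 0"
      "u * f1 - poly (p ^ j + r) (b / a) \<in> mpow R1 (N1 + 2)"
    using Q.weierstrass[OF IH(1)] by blast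
  define d where "d = degree (p ^ j)"
  define f1' where "f1' = poly (p ^ j + r) (b / a)"
  define \<delta> where "\<delta> = f1' - u * f1"
  have \<delta>: "\<delta> \<in> mpow R1 (N1 + 2)"
    using Q.T.idealD(7)[OF Q.T.mpow_ideal W(4)] by (simp add: \<delta>_def f1'_def)
  have unit_dom: "c \<in> \<beta> - nonunits \<beta>" if "c \<in> R1 - nonunits R1" "R1 \<subseteq> \<beta>" for c \<beta>
    using that unfolding nonunits_def by blast
  define f where "f = a ^ d * f1'"
  have rR: "r \<in> poly_over R" using W(2) Q.poly_over_m(1) by blast
  have fR: "f \<in> R"
    unfolding f_def f1'_def
  proof (rule Q.clear_denominators_in)
    show "p ^ j + r \<in> poly_over R" using rR by (intro Q.poly_over_closed Q.poly_over_power Q.p_in)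
    show "coeff (p ^ j + r) i = 0" if "d < i" for i using that W(3) by (simp add: d_def coeff_eq_0)
  qed
  have eS: "a ^ d * e1 \<in> S" using IH(2) dom Q.S_subset Q.x_in by blast
  have "\<exists>g\<in>diagonal_params. f = a ^ d * e1 * g"
  proof -
    obtain w where w: "w \<in> mpow S 2" "\<delta> = e1 * w"
      using Q.T.mpow_divides_shift[OF field_subring_axioms dom(2) bspec[OF IH(5)] \<delta>] by blast
    have "f = a ^ d * e1 * (u * g1 + w)"
      using w(2) IH(4) by (simp add: f_def \<delta>_def algebra_simps)
    moreover have "u * g1 + w \<in> diagonal_params"
      by (rule diagonal_params_perturb[OF IH(3) unit_dom[OF W(1) dom(1)] w(1)])
    ultimately show ?thesis by blast
  qed
  then obtain g where g: "g \<in> diagonal_params" "f = a ^ d * e1 * g" by blast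
  \<comment> \<open>Of the \<open>N1 + d\<close> factors, \<open>d\<close> supply
    \<open>a ^ d\<close>, and \<open>N1\<close> are left in \<open>R1\<close> for \<open>e1\<close>
    or \<open>f1\<close>. Thus the new exponent does not depend on \<open>\<beta>\<close>.\<close>
  have fac: "\<exists>w\<in>mpow R1 N1. z = a ^ d * w" if "z \<in> mpow R (N1 + d)" for z
    using Q.mpow_factor[OF that, of d] by simp
  then have div_e: "\<exists>w\<in>S. z = a ^ d * e1 * w" if "z \<in> mpow R (N1 + d)" for z
    using IH(5) that by (metis mult.assoc)
  have div_f: "\<exists>w\<in>\<beta>. z = f * w"
    if \<beta>: "local_quadratic_transform\<^sup>*\<^sup>* R \<beta>" "\<not> S \<subseteq> \<beta>" "\<not> \<beta> \<subseteq> S" and z: "z \<in> mpow R (N1 + d)" for \<beta> z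
  proof -
    have "R \<subseteq> S" using dom Q.S_subset by blast
    then have "\<beta> \<noteq> R" using \<beta>(3) by blast
    then obtain R' where R': "local_quadratic_transform R R'" "local_quadratic_transform\<^sup>*\<^sup>* R' \<beta>"
      using \<beta>(1) by (metis converse_rtranclpE)
    note good' = regular_surface_ring_transform(1)[OF step.prems R'(1)]
    have dom': "R' \<subseteq> \<beta>" "nonunits R' \<subseteq> nonunits \<beta>" "regular_surface_ring \<beta>" using tree_dominates[OF R'(2) good'] by auto
    then obtain s t where "regular_params \<beta> s t" by (auto simp: regular_surface_ring_def)
    then interpret B: regular_params \<beta> s t .
    show ?thesis
    proof (cases "R' = R1")
      case True
      have div: "\<exists>w\<in>\<beta>. z = f1 * w" if "z \<in> mpow R1 N1" for z
        using IH(6) \<beta> that R'(2) True by blast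
      obtain w0 where w0: "w0 \<in> mpow \<beta> 2" "\<delta> = f1 * w0"
        using Q.T.mpow_divides_shift[OF B.field_subring_axioms _ div \<delta>] dom'(2) True by blast
      have "w0 \<in> nonunits \<beta>"
        using w0(1) B.mpow_Suc_subset_nonunits[OF B.ideal_nonunits, of 1] by (auto simp: numeral_2_eq_2)
      then have "u + w0 \<in> \<beta> - nonunits \<beta>"
        using B.unit_add_nonunit[OF B.ideal_nonunits unit_dom[OF W(1)]] dom'(1) True by blast
      then have c: "inverse (u + w0) \<in> \<beta>" "u + w0 \<noteq> 0" using B.unitD by auto
      \<comment> \<open>Over \<open>R1\<close>, passing from \<open>f1\<close> to its Weierstrass
        form only multiplies it by the unit \<open>u + w0\<close> of \<open>\<beta>\<close>, so the
        induction hypothesis still applies.\<close>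
      have f1': "f1' = f1 * (u + w0)" using w0(2) by (simp add: \<delta>_def algebra_simps)
      obtain w where w: "w \<in> mpow R1 N1" "z = a ^ d * w" using fac[OF z] by blast
      obtain w' where w': "w' \<in> \<beta>" "w = f1 * w'" using div[OF w(1)] by blast
      have "z = f * (inverse (u + w0) * w')" using w w' c by (simp add: f_def f1')
      then show ?thesis using w' c by blast
    next
      case False
      \<comment> \<open>Here \<open>\<beta>\<close> lies over a different point of the exceptional
        line, which the strict transform of \<open>f\<close> avoids.\<close>
      obtain a' b' p' where T': "quadratic_transform R a' b' R' p'"
        using regular_surface_ring_transform(2)[OF step.prems R'(1)] by blast
      have "z \<in> mpow R d" using z Q.mpow_antimono[of d "N1 + d"] by auto
      then obtain w where "w \<in> R'" "z = f * w"
        using Q.strict_transform_off_other_points[OF T' False W(2,3)] unfolding f_def f1'_def d_def by blast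
      then show ?thesis using dom' by blast
    qed
  qed
  show ?case
    by (intro bexI[OF _ fR] exI[of _ "N1 + d"] bexI[OF _ eS] bexI[OF _ g(1)] conjI g(2) ballI allI impI div_e div_f)
qed

end

section \<open>Regular parameters of the root as monomials along the tree\<close>

context quadratic_transform begin

text \<open>Here \<open>v\<close> is a linear form \<open>x * c + y * e\<close> with
  \<open>e\<close> a unit, and its strict transform passes through \<open>T\<close>. So a linear
  polynomial vanishes at the point, \<open>p\<close> has degree 1 by minimality, and
  \<open>v / x\<close> is \<open>e * poly p (y / x)\<close> plus a multiple of
  \<open>x\<close>.\<close>

lemma monomial_params_ratio_nonunit:
  assumes uv: "regular_params S u v" and v': "v / x \<in> nonunits T"
  shows "regular_params T x (v / x)"
proof -
  interpret uv: regular_params S u v by (rule uv)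
  obtain c e where ce: "v = x * c + y * e" "c \<in> S" "e \<in> S" using uv.y_nonunit unfolding nonunits_eq by blast
  have vx: "v / x = c + e * (y / x)" using ce x_nz by (simp add: field_simps)
  \<comment> \<open>If \<open>e\<close> were a nonunit, so would be \<open>c\<close>, and
    \<open>v\<close> would lie in the square of the maximal ideal. Rewriting \<open>x\<close>,
    \<open>y\<close> in terms of \<open>u\<close>, \<open>v\<close> then makes \<open>v\<close>
    times a unit a multiple of \<open>u\<close>, against regularity.\<close>
  have e: "e \<notin> nonunits S"
  proof
    assume e: "e \<in> nonunits S"
    then have "e * (y / x) \<in> nonunits T"
      using T.nonunits_idealD(6)[OF _ ratio_in] nonunits_subset_T by blast
    then have "v / x - e * (y / x) \<in> nonunits T" by (rule T.nonunits_idealD(8)[OF v'])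
    then have "c \<in> nonunits S" using nonunits_T_iff[OF ce(2)] by (simp add: vx)
    obtain x1 x2 y1 y2 where xy: "x = u * x1 + v * x2" "y = u * y1 + v * y2" "x1 \<in> S" "x2 \<in> S" "y1 \<in> S" "y2 \<in> S"
      using x_nonunit y_nonunit unfolding uv.nonunits_eq by blast
    have "v * (1 + - (x2 * c + y2 * e)) = u * (x1 * c + y1 * e)"
      using ce(1) unfolding xy(1,2) by (simp add: algebra_simps)
    moreover have "1 + - (x2 * c + y2 * e) \<in> S - nonunits S"
      using xy(3-6) \<open>c \<in> nonunits S\<close> e
      by (intro unit_add_nonunit[OF ideal_nonunits] nonunits_idealD(7) nonunits_idealD(4) nonunits_idealD(5)) auto
    moreover have "x1 * c + y1 * e \<in> S" using xy(3-6) ce(2,3) by auto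
    ultimately obtain w where "w \<in> S" "1 + - (x2 * c + y2 * e) = u * w"
      using regular_params.regular[OF uv.swap_params] by blast
    then show False using \<open>1 + - (x2 * c + y2 * e) \<in> S - nonunits S\<close> nonunits_idealD(6)[OF uv.x_nonunit] by auto
  qed
  then have ie: "inverse e \<in> S" "e \<noteq> 0" using unitD[of e] ce by auto
  define l where "l = [:c * inverse e, 1:]"
  have l: "l \<in> poly_over S" unfolding l_def using ce ie by (intro poly_over_closed) auto
  have le: "poly l (y / x) = inverse e * (v / x)" using ie by (simp add: l_def vx field_simps)
  then have "poly l (y / x) \<in> nonunits T" using T.nonunits_mult[OF _ v'] ie(1) S_subset by (metis subsetD)
  then have "degree p \<le> 1" using minimal[OF l] by (simp add: l_def)
  then have "coeff p (Suc (Suc i)) = 0" for i by (intro coeff_eq_0) auto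
  then have "p = [:coeff p 0, coeff p 1:]" by (auto simp: poly_eq_iff coeff_pCons split: nat.split)
  then obtain c0 c1 where p: "p = [:c0, c1:]" by blast
  have "c1 = 1"
  proof (rule ccontr)
    assume "c1 \<noteq> 1"
    then have "p = 1" using monic p by (auto split: if_splits simp: one_pCons)
    then have "poly p (y / x) = 1" by simp
    then show False using T.y_nonunit T.one_not_nonunits by simp
  qed
  then have pt: "poly p (y / x) = c0 + y / x" using p by simp
  have c0: "c0 \<in> S" using poly_overD[OF p_in, of 0] p by simp
  have "poly l (y / x) - poly p (y / x) \<in> nonunits T"
    by (rule T.nonunits_idealD(8)[OF \<open>poly l (y / x) \<in> nonunits T\<close> T.y_nonunit])
  then have "c * inverse e - c0 \<in> nonunits T" by (simp add: pt l_def)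
  then have "c * inverse e - c0 \<in> nonunits S" using nonunits_T_iff ce c0 ie by auto
  then obtain q where q: "q \<in> T" "c * inverse e - c0 = x * q" using nonunits_factor_T by blast
  have "v / x = e * poly p (y / x) + e * q * x"
  proof -
    have "v / x = e * poly l (y / x)" using le ie by simp
    also have "poly l (y / x) = poly p (y / x) + x * q" using q(2) by (simp add: pt l_def algebra_simps)
    finally show ?thesis by (simp add: algebra_simps)
  qed
  moreover have "e \<in> T - nonunits T" using e ce nonunits_T_iff S_subset by blast
  moreover have "e * q \<in> T" using q ce S_subset by blast
  ultimately have "regular_params T (v / x) x"
    using regular_params.change_first_param[OF T.swap_params] by simp
  then show ?thesis by (rule regular_params.swap_params)
qed

text \<open>Both parameters are multiples of \<open>x\<close>, which collects the exponent
  \<open>k + l\<close>. Since \<open>x\<close> is itself a combination of \<open>u\<close> and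
  \<open>v\<close>, at most one of the quotients \<open>u'\<close>, \<open>v'\<close> is a nonunit
  at \<open>T\<close>. That one serves as the second parameter; if there is none, the point's own
  \<open>poly p (y / x)\<close> does, with exponent 0.\<close>

lemma monomial_transform:
  assumes uv: "regular_params S u v" and w: "w \<in> S - nonunits S"
  shows "\<exists>u' v' w' k' l'. regular_params T u' v' \<and> w' \<in> T - nonunits T \<and> w * u ^ k * v ^ l = w' * u' ^ k' * v' ^ l'"
proof -
  interpret uv: regular_params S u v by (rule uv)
  obtain u' v' where u': "u' \<in> T" "u = x * u'" and v': "v' \<in> T" "v = x * v'"
    using nonunits_factor_T[OF uv.x_nonunit] nonunits_factor_T[OF uv.y_nonunit] by blast
  have u'_eq: "u' = u / x" "v' = v / x" using u' v' x_nz by auto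
  have wT: "w \<in> T - nonunits T" using w nonunits_T_iff S_subset by blast
  have eq: "w * u ^ k * v ^ l = w * u' ^ k * v' ^ l * x ^ (k + l)"
    using u'(2) v'(2) by (simp add: power_mult_distrib power_add mult_ac)
  obtain s s' where ss: "x = u * s + v * s'" "s \<in> S" "s' \<in> S" using x_nonunit unfolding uv.nonunits_eq by blast
  have "x * (u' * s + v' * s') = x * 1" using ss u' v' by (simp add: algebra_simps)
  then have one: "u' * s + v' * s' = 1" using x_nz by simp
  have not_both: "\<not> (u' \<in> nonunits T \<and> v' \<in> nonunits T)"
  proof
    assume "u' \<in> nonunits T \<and> v' \<in> nonunits T"
    then have "u' * s + v' * s' \<in> nonunits T"
      using ss S_subset by (intro T.nonunits_idealD(4) T.nonunits_idealD(6)) auto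
    then show False using one by simp
  qed
  consider "u' \<in> T - nonunits T" "v' \<in> T - nonunits T" | "u' \<in> T - nonunits T" "v' \<in> nonunits T"
    | "u' \<in> nonunits T" "v' \<in> T - nonunits T"
    using not_both u' v' by blast
  then show ?thesis
  proof cases
    case 1
    then have "w * u' ^ k * v' ^ l \<in> T - nonunits T" using wT T.unit_mult T.unit_power by blast
    moreover have "w * u ^ k * v ^ l = (w * u' ^ k * v' ^ l) * x ^ (k + l) * poly p (y / x) ^ 0" using eq by simp
    ultimately show ?thesis using T_params by blast
  next
    case 2
    then have "w * u' ^ k \<in> T - nonunits T" using wT T.unit_mult T.unit_power by blast
    moreover have "w * u ^ k * v ^ l = (w * u' ^ k) * x ^ (k + l) * v' ^ l" using eq by (simp add: mult_ac)
    moreover have "regular_params T x v'" using monomial_params_ratio_nonunit[OF uv] 2 u'_eq by simp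
    ultimately show ?thesis by blast
  next
    case 3
    then have "w * v' ^ l \<in> T - nonunits T" using wT T.unit_mult T.unit_power by blast
    moreover have "w * u ^ k * v ^ l = (w * v' ^ l) * x ^ (k + l) * u' ^ k" using eq by (simp add: mult_ac)
    moreover have "regular_params T x u'" using monomial_params_ratio_nonunit[OF uv.swap_params] 3 u'_eq by simp
    ultimately show ?thesis by blast
  qed
qed

end

text \<open>The total transform of the curve \<open>c = 0\<close> keeps normal crossings. The
  induction starts from \<open>c\<close> with exponents 1 and 0.\<close>

lemma monomial_in_tree:
  assumes "local_quadratic_transform\<^sup>*\<^sup>* D T" "regular_surface_ring D" "regular_params D c y"
  shows "\<exists>u v w k l. regular_params T u v \<and> w \<in> T - nonunits T \<and> c = w * u ^ k * v ^ l"
  using assms(1)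
proof (induction rule: rtranclp_induct)
  case base
  interpret regular_params D c y by fact
  have "1 \<in> D - nonunits D" "c = 1 * c ^ 1 * y ^ 0" by simp_all
  then show ?case using assms(3) by blast
next
  case (step T T')
  then have "regular_surface_ring T" using tree_dominates assms(2) by blast
  then obtain a b p where "quadratic_transform T a b T' p"
    using regular_surface_ring_transform(2)[OF _ step.hyps(2)] by blast
  then interpret quadratic_transform T a b T' p .
  show ?case using step.IH monomial_transform by metis
qed

theorem theorem8p6:
  fixes D :: "'a::field set" and U :: "'a set set"
  assumes "subring D ring_of_type_algebra"
    and "is_quotient_field_of D"
    and "regular_local_ring (ring_on D)"
    and "krull_dim (ring_on D) = 2"
    and "henselian D"
    and "U \<subseteq> quadratic_tree D"
    and "pairwise (\<lambda>\<alpha> \<beta>. \<not> \<alpha> \<subseteq> \<beta> \<and> \<not> \<beta> \<subseteq> \<alpha>) U"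
  shows "irredundant U"
  unfolding irredundant_def
proof
  fix \<alpha> assume \<alpha>: "\<alpha> \<in> U"
  obtain c y where cy: "regular_params D c y" using regular_local_ring_2_params assms by blast
  interpret D: regular_params D c y by (rule cy)
  have good: "regular_surface_ring D" using cy assms(4) by (auto simp: regular_surface_ring_def)
  have tree: "local_quadratic_transform\<^sup>*\<^sup>* D \<beta>" if "\<beta> \<in> U" for \<beta>
    using that assms(6) quadratic_tree_iff by blast
  obtain u v w k l where uv: "regular_params \<alpha> u v" "w \<in> \<alpha> - nonunits \<alpha>" "c = w * u ^ k * v ^ l"
    using monomial_in_tree[OF tree[OF \<alpha>] good cy] by blast
  interpret A: regular_params \<alpha> u v by (rule uv(1))
  obtain f N e g where f: "e \<in> \<alpha>" "g \<in> A.diagonal_params" "f = e * g" "\<forall>z\<in>mpow D N. \<exists>w\<in>\<alpha>. z = e * w"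
    "\<forall>\<beta>. local_quadratic_transform\<^sup>*\<^sup>* D \<beta> \<longrightarrow> \<not> \<alpha> \<subseteq> \<beta> \<longrightarrow> \<not> \<beta> \<subseteq> \<alpha> \<longrightarrow>
      (\<forall>z\<in>mpow D N. \<exists>w\<in>\<beta>. z = f * w)"
    using A.separating_element[OF tree[OF \<alpha>] good] by (elim bexE exE conjE) (rule that)
  have cN: "c ^ N \<in> mpow D N" by (rule D.nonunit_power_in_mpow[OF D.x_nonunit])
  \<comment> \<open>A zero \<open>e\<close> could not divide the nonzero element
    \<open>c ^ N\<close>.\<close>
  have "e \<noteq> 0" using bspec[OF f(4) cN] D.x_nz by auto
  then have f_nz: "f \<noteq> 0" using f(3) A.diagonal_params_nz[OF f(2)] by simp
  have "c ^ N / f \<notin> \<alpha>"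
  proof
    assume h: "c ^ N / f \<in> \<alpha>"
    \<comment> \<open>Multiplied by the strict transform \<open>g\<close>, this gives back
      \<open>c ^ N\<close>, a unit times a monomial in \<open>u\<close> and \<open>v\<close>, which
      \<open>g\<close> cannot divide in \<open>\<alpha>\<close>.\<close>
    define q where "q = e * (c ^ N / f)"
    have "g * q = w ^ N * u ^ (k * N) * v ^ (l * N)"
      using f_nz f(3) by (simp add: q_def uv(3) power_mult_distrib power_mult)
    moreover have "q \<in> \<alpha>" unfolding q_def by (rule A.mult_in[OF f(1) h])
    ultimately show False
      using A.diagonal_params_not_dvd_monomial[OF f(2) A.unit_power[OF uv(2)]] by blast
  qed
  moreover have "c ^ N / f \<in> \<beta>" if \<beta>: "\<beta> \<in> U - {\<alpha>}" for \<beta>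
  proof -
    have "\<not> \<alpha> \<subseteq> \<beta>" "\<not> \<beta> \<subseteq> \<alpha>" using assms(7) \<alpha> \<beta> unfolding pairwise_def by blast+
    then obtain b where "b \<in> \<beta>" "c ^ N = f * b" using f(5) tree \<beta> cN by blast
    then show ?thesis using f_nz by simp
  qed
  ultimately show "\<Inter>U \<subset> \<Inter>(U - {\<alpha>})" using \<alpha> by blast
qed

end
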